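(* Let $A:\operatorname{dom}A\to F$ be a subpositive operator on the $w^*$-sequentially complete anti-dual pair $\langle F,E\rangle$, with Krein--von Neumann extension $A_N$. Suppose that $B,C\in\mathscr{L}(E;E)$ are two weakly continuous operators leaving $\operatorname{dom}A$ invariant, and that the spectrum of $BC$ restricted to $\operatorname{dom}A$ is bounded. Assume in addition that $$C^*A\subset AB\qquad\text{and}\qquad B^*A\subset AC.$$ Then $$C^*A_N=A_NB\qquad\text{and}\qquad B^*A_N=A_NC.$$
   Context: An anti-dual pair $\langle F,E\rangle$ consists of complex vector spaces $E,F$ and a map $\langle\cdot,\cdot\rangle:F\times E\to\mathbb{C}$, linear in the first and conjugate linear in the second variable, which separates points of both spaces ($\langle f,x\rangle=0$ for all $x\in E$ implies $f=0$; $\langle f,x\rangle=0$ for all $f\in F$ implies $x=0$). $\sigma(E,F)$ and $\sigma(F,E)$ are the smallest topologies on $E$, resp. $F$, making all maps $x\mapsto\langle f,x\rangle$ ($f\in F$), resp. $f\mapsto\langle f,x\rangle$ ($x\in E$), continuous. The pair is $w^*$-sequentially complete if $(F,\sigma(F,E))$ is sequentially complete. $\mathscr{L}(E;F)$ denotes the set of everywhere defined $\sigma(E,F)$-$\sigma(F,E)$ continuous linear operators $E\to F$, and $\mathscr{L}(E;E)$ the set of $\sigma(E,F)$-$\sigma(E,F)$ continuous linear operators $E\to E$ (weakly continuous operators). The adjoint of $B\in\mathscr{L}(E;E)$ is the operator $B^*:F\to F$ with $\langle B^*f,x\rangle=\langle f,Bx\rangle$ for all $f\in F$, $x\in E$.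 A linear operator $A:E\supseteq\operatorname{dom}A\to F$ is positive if $\langle Ax,x\rangle\geq 0$ for all $x\in\operatorname{dom}A$; for $S,T\in\mathscr{L}(E;F)$, $S\leq T$ means $\langle (T-S)x,x\rangle\geq 0$ for all $x\in E$. A linear operator $A$ from a linear subspace $\operatorname{dom}A\subseteq E$ to $F$ is subpositive if it has a positive extension in $\mathscr{L}(E;F)$; equivalently, for every $y\in E$ there is $M_y\geq0$ with $|\langle Ax,y\rangle|^2\leq M_y\langle Ax,x\rangle$ for all $x\in\operatorname{dom}A$. Every subpositive operator on a $w^*$-sequentially complete anti-dual pair has a smallest positive extension in $\mathscr{L}(E;F)$ with respect to $\leq$; it is the Krein--von Neumann extension, denoted $A_N$. The inclusion $C^*A\subset AB$ means $C^*Ax=ABx$ for all $x\in\operatorname{dom}A$, and similarly for $B^*A\subset AC$. The spectrum of $BC$ restricted to $\operatorname{dom}A$ is the set of $\lambda\in\mathbb{C}$ for which $(BC-\lambda I)|_{\operatorname{dom}A}:\operatorname{dom}A\to\operatorname{dom}A$ is not a bijection with inverse continuous for the topology induced on $\operatorname{dom}A$ by $\sigma(E,F)$. *)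

theory Defs
  imports "HOL-Analysis.Analysis"
begin

text \<open>
  Complex vector spaces are given by the \<^locale>\<open>vector_space\<close> locale: the types \<open>'e\<close> and \<open>'f\<close>
  carry the additive structure of \<open>E\<close> and \<open>F\<close>, and \<open>sE\<close>, \<open>sF\<close> are the complex scalar
  multiplications. The pairing \<open>\<langle>f, x\<rangle>\<close> is written \<open>ip f x\<close>.
\<close>

locale anti_dual_pair = E: vector_space sE + F: vector_space sF
  for sE :: "complex \<Rightarrow> 'e::ab_group_add \<Rightarrow> 'e"
  and sF :: "complex \<Rightarrow> 'f::ab_group_add \<Rightarrow> 'f" +
  fixes ip :: "'f \<Rightarrow> 'e \<Rightarrow> complex"
  assumes add_left: "ip (f + g) x = ip f x + ip g x"
    and scale_left: "ip (sF c f) x = c * ip f x"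
    and add_right: "ip f (x + y) = ip f x + ip f y"
    and scale_right: "ip f (sE c x) = cnj c * ip f x"
    and separates_left: "(\<And>x. ip f x = 0) \<Longrightarrow> f = 0"
    and separates_right: "(\<And>f. ip f x = 0) \<Longrightarrow> x = 0"

definition sigma_E :: "('f \<Rightarrow> 'e \<Rightarrow> complex) \<Rightarrow> 'e topology" where
  "sigma_E ip = topology_generated_by {{x. ip f x \<in> U} | f U. open U}"

definition sigma_F :: "('f \<Rightarrow> 'e \<Rightarrow> complex) \<Rightarrow> 'f topology" where
  "sigma_F ip = topology_generated_by {{f. ip f x \<in> U} | x U. open U}"

text \<open>
  Cauchy sequences are those of the translation-invariant uniformity of \<open>\<sigma>(F,E)\<close>, expressed by the
  open neighbourhoods of \<open>0\<close>.
\<close>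

definition weak_star_Cauchy :: "('f::ab_group_add \<Rightarrow> 'e \<Rightarrow> complex) \<Rightarrow> (nat \<Rightarrow> 'f) \<Rightarrow> bool" where
  "weak_star_Cauchy ip s \<longleftrightarrow>
     (\<forall>U. openin (sigma_F ip) U \<and> 0 \<in> U \<longrightarrow> (\<exists>N. \<forall>m\<ge>N. \<forall>n\<ge>N. s m - s n \<in> U))"

definition weak_star_seq_complete :: "('f::ab_group_add \<Rightarrow> 'e \<Rightarrow> complex) \<Rightarrow> bool" where
  "weak_star_seq_complete ip \<longleftrightarrow>
     (\<forall>s. weak_star_Cauchy ip s \<longrightarrow> (\<exists>f. limitin (sigma_F ip) s f sequentially))"

definition weak_ops_EF ::
  "(complex \<Rightarrow> 'e::ab_group_add \<Rightarrow> 'e) \<Rightarrow> (complex \<Rightarrow> 'f::ab_group_add \<Rightarrow> 'f) \<Rightarrow>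
   ('f \<Rightarrow> 'e \<Rightarrow> complex) \<Rightarrow> ('e \<Rightarrow> 'f) set" where
  "weak_ops_EF sE sF ip =
     {T. Vector_Spaces.linear sE sF T \<and> continuous_map (sigma_E ip) (sigma_F ip) T}"

definition weak_ops_EE ::
  "(complex \<Rightarrow> 'e::ab_group_add \<Rightarrow> 'e) \<Rightarrow> ('f \<Rightarrow> 'e \<Rightarrow> complex) \<Rightarrow> ('e \<Rightarrow> 'e) set" where
  "weak_ops_EE sE ip =
     {T. Vector_Spaces.linear sE sE T \<and> continuous_map (sigma_E ip) (sigma_E ip) T}"

text \<open>
  For \<open>B\<close> in \<^const>\<open>weak_ops_EE\<close> the functional \<open>x \<mapsto> \<langle>f, B x\<rangle>\<close> is weakly continuous, hence represented
  by an element of \<open>F\<close>, which is unique since the pairing separates the points of \<open>F\<close>.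
\<close>

definition adj :: "('f \<Rightarrow> 'e \<Rightarrow> complex) \<Rightarrow> ('e \<Rightarrow> 'e) \<Rightarrow> 'f \<Rightarrow> 'f" where
  "adj ip B f = (THE g. \<forall>x. ip g x = ip f (B x))"

text \<open>
  A partially defined operator is a domain \<open>D\<close> together with a function whose values outside \<open>D\<close>
  are irrelevant.
\<close>

definition linear_operator_on ::
  "(complex \<Rightarrow> 'e::ab_group_add \<Rightarrow> 'e) \<Rightarrow> (complex \<Rightarrow> 'f::ab_group_add \<Rightarrow> 'f) \<Rightarrow>
   'e set \<Rightarrow> ('e \<Rightarrow> 'f) \<Rightarrow> bool" where
  "linear_operator_on sE sF D A \<longleftrightarrow>
     module.subspace sE D \<and>
     (\<forall>x\<in>D. \<forall>y\<in>D. A (x + y) = A x + A y) \<and>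
     (\<forall>c. \<forall>x\<in>D. A (sE c x) = sF c (A x))"

definition positive_operator_on :: "('f \<Rightarrow> 'e \<Rightarrow> complex) \<Rightarrow> 'e set \<Rightarrow> ('e \<Rightarrow> 'f) \<Rightarrow> bool" where
  "positive_operator_on ip D A \<longleftrightarrow> (\<forall>x\<in>D. ip (A x) x \<in> \<real>\<^sub>\<ge>\<^sub>0)"

definition operator_le ::
  "('f::ab_group_add \<Rightarrow> 'e \<Rightarrow> complex) \<Rightarrow> ('e \<Rightarrow> 'f) \<Rightarrow> ('e \<Rightarrow> 'f) \<Rightarrow> bool" where
  "operator_le ip S T \<longleftrightarrow> (\<forall>x. ip (T x - S x) x \<in> \<real>\<^sub>\<ge>\<^sub>0)"

definition positive_extensions ::
  "(complex \<Rightarrow> 'e::ab_group_add \<Rightarrow> 'e) \<Rightarrow> (complex \<Rightarrow> 'f::ab_group_add \<Rightarrow> 'f) \<Rightarrow>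
   ('f \<Rightarrow> 'e \<Rightarrow> complex) \<Rightarrow> 'e set \<Rightarrow> ('e \<Rightarrow> 'f) \<Rightarrow> ('e \<Rightarrow> 'f) set" where
  "positive_extensions sE sF ip D A =
     {T \<in> weak_ops_EF sE sF ip. positive_operator_on ip UNIV T \<and> (\<forall>x\<in>D. T x = A x)}"

definition subpositive ::
  "(complex \<Rightarrow> 'e::ab_group_add \<Rightarrow> 'e) \<Rightarrow> (complex \<Rightarrow> 'f::ab_group_add \<Rightarrow> 'f) \<Rightarrow>
   ('f \<Rightarrow> 'e \<Rightarrow> complex) \<Rightarrow> 'e set \<Rightarrow> ('e \<Rightarrow> 'f) \<Rightarrow> bool" where
  "subpositive sE sF ip D A \<longleftrightarrow>
     linear_operator_on sE sF D A \<and> positive_extensions sE sF ip D A \<noteq> {}"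

text \<open>
  The smallest positive extension. It exists for every subpositive operator on a
  \<open>w\<^sup>*\<close>-sequentially complete anti-dual pair, and it is unique because \<^const>\<open>operator_le\<close> is
  antisymmetric on linear operators by polarization.
\<close>

definition krein_von_neumann ::
  "(complex \<Rightarrow> 'e::ab_group_add \<Rightarrow> 'e) \<Rightarrow> (complex \<Rightarrow> 'f::ab_group_add \<Rightarrow> 'f) \<Rightarrow>
   ('f \<Rightarrow> 'e \<Rightarrow> complex) \<Rightarrow> 'e set \<Rightarrow> ('e \<Rightarrow> 'f) \<Rightarrow> 'e \<Rightarrow> 'f" where
  "krein_von_neumann sE sF ip D A =
     (THE T. T \<in> positive_extensions sE sF ip D A \<and>
             (\<forall>S\<in>positive_extensions sE sF ip D A. operator_le ip T S))"

definition spectrum_on ::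
  "(complex \<Rightarrow> 'e::ab_group_add \<Rightarrow> 'e) \<Rightarrow> ('f \<Rightarrow> 'e \<Rightarrow> complex) \<Rightarrow>
   'e set \<Rightarrow> ('e \<Rightarrow> 'e) \<Rightarrow> complex set" where
  "spectrum_on sE ip D T =
     {z. \<not> (bij_betw (\<lambda>x. T x - sE z x) D D \<and>
            continuous_map (subtopology (sigma_E ip) D) (subtopology (sigma_E ip) D)
              (inv_into D (\<lambda>x. T x - sE z x)))}"

end

theory Submission
  imports Defs
begin

text \<open>
  Let \<open>N\<close> be the smallest positive extension. It sends \<open>y\<close> to the weak limit of \<open>A u\<^sub>n\<close>, where \<open>u\<^sub>n\<close> in
  \<open>dom A\<close> approximates \<open>y\<close> best for the seminorm of any positive extension; equivalently, \<open>dom A\<close> is dense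
  for the seminorm of the form \<open>\<langle>N x, y\<rangle>\<close>. On \<open>dom A\<close> the operators \<open>B\<close> and \<open>C\<close> are formally
  adjoint for this form, so by density it is enough that they are bounded for the seminorm on \<open>dom A\<close>,
  and for this it is enough that the positive symmetric operator \<open>G = BC/c\<close> is bounded for some \<open>c > 0\<close>.

  For \<open>c\<close> beyond the spectrum of \<open>BC\<close>, put \<open>T = (1 + G)\<^sup>-\<^sup>1\<close>, so \<open>0 \<le> T \<le> 1\<close>. The spectral
  measure \<open>\<mu>\<^sub>x\<close> of \<open>T\<close> at \<open>x\<close> is replaced by the array of its moments \<open>\<langle>T\<^sup>k (1 - T)\<^sup>l x, x\<rangle>\<close>. Since
  \<open>T - s\<close> is onto for every \<open>s\<close> in \<open>[0, 1/2)\<close>, we may write \<open>x = (T - s) u\<close>, whence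
  \<open>d\<mu>\<^sub>x = (t - s)\<^sup>2 d\<mu>\<^sub>u\<close>. So the second differences with step \<open>d\<close> at \<open>s\<close> of the function
  \<open>k(s) = \<integral> max 0 (s - t) d\<mu>\<^sub>x(t)\<close> are \<open>O(d\<^sup>3)\<close>, and \<open>k(s) = O(s\<^sup>3)\<close> at \<open>0\<close>. Hence \<open>k\<close> vanishes on
  \<open>[0, 1/2)\<close>, that is \<open>T \<ge> 1/2\<close>, which bounds \<open>G\<close> by \<open>1\<close>.
\<close>

section \<open>Second differences of a function of one real variable\<close>

text \<open>Schwarz's argument: a small parabola added to the difference of \<open>k\<close> and its chord would have an
  interior maximum, so \<open>k\<close> lies above its chord, which the cubic bound at \<open>0\<close> forbids.\<close>

lemma second_difference_vanishing:
  fixes k :: "real \<Rightarrow> real"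
  assumes b: "0 < b" and cont: "continuous_on {0..b} k" and k0: "0 \<le> k 0"
    and cubic: "\<And>s. 0 \<le> s \<Longrightarrow> s \<le> b \<Longrightarrow> k s \<le> K * s ^ 3"
    and second: "\<And>s. 0 < s \<Longrightarrow> s < b \<Longrightarrow>
      \<exists>M. \<forall>d>0. d \<le> s \<longrightarrow> s + d \<le> b \<longrightarrow> k (s + d) + k (s - d) - 2 * k s \<le> M * d ^ 3"
  shows "k b \<le> 0"
proof (rule ccontr)
  assume "\<not> k b \<le> 0"
  define l where "l = k b / b"
  have l: "l > 0" using \<open>\<not> k b \<le> 0\<close> b by (simp add: l_def)
  \<comment> \<open>This size keeps the parabola below half of the chord; its second difference
    \<open>2 * e * d^2\<close> outweighs a cubic error for small \<open>d\<close>.\<close>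
  define e where "e = l / (2 * b)"
  have e: "e > 0" using l b by (simp add: e_def)
  define g where "g s = l * s - k s - e * (s * (b - s))" for s
  have "continuous_on {0..b} g"
    unfolding g_def by (intro continuous_intros cont)
  then obtain s0 where s0: "s0 \<in> {0..b}" and max: "\<And>s. s \<in> {0..b} \<Longrightarrow> g s \<le> g s0"
    using continuous_attains_sup[of "{0..b}" g] b by (metis atLeastAtMost_iff compact_Icc empty_iff less_eq_real_def)
  have "g s0 \<le> 0"
  proof (rule ccontr)
    assume pos: "\<not> g s0 \<le> 0"
    have "g 0 \<le> 0" "g b \<le> 0" using k0 b by (auto simp: g_def l_def)
    with pos have "s0 \<noteq> 0" "s0 \<noteq> b" by auto
    with s0 have s0': "0 < s0" "s0 < b" by auto
    obtain M where M: "\<And>d. 0 < d \<Longrightarrow> d \<le> s0 \<Longrightarrow> s0 + d \<le> b \<Longrightarrow>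
        k (s0 + d) + k (s0 - d) - 2 * k s0 \<le> M * d ^ 3"
      using second[OF s0'] by blast
    define d where "d = min (min s0 (b - s0)) (e / (\<bar>M\<bar> + 1))"
    have d: "0 < d" "d \<le> s0" "s0 + d \<le> b" "d \<le> e / (\<bar>M\<bar> + 1)"
      using s0' e by (auto simp: d_def)
    have "M * d \<le> (\<bar>M\<bar> + 1) * d" using d(1) by (intro mult_right_mono) auto
    also have "\<dots> \<le> e" using d(4) by (simp add: field_simps)
    finally have Md: "M * d \<le> e" .
    have "g (s0 + d) + g (s0 - d) \<le> 2 * g s0"
      using max[of "s0 + d"] max[of "s0 - d"] d s0' by simp
    moreover have "g (s0 + d) + g (s0 - d) - 2 * g s0
        = 2 * e * d^2 - (k (s0 + d) + k (s0 - d) - 2 * k s0)"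
      by (simp add: g_def algebra_simps power2_eq_square)
    ultimately have "2 * e * d^2 \<le> M * d ^ 3" using M[OF d(1-3)] by linarith
    also have "\<dots> = (M * d) * d^2" by (simp add: power3_eq_cube power2_eq_square)
    also have "\<dots> \<le> e * d^2" by (rule mult_right_mono[OF Md]) simp
    finally show False using e d(1) by simp
  qed
  then have low: "l * s - e * (s * (b - s)) \<le> k s" if "0 \<le> s" "s \<le> b" for s
    using max[of s] that by (simp add: g_def)
  \<comment> \<open>At so small an \<open>s\<close> the cubic bound is at most a quarter of the
    chord, while half of the chord is a lower bound.\<close>
  define s where "s = min (min b 1) (l / (4 * (\<bar>K\<bar> + 1)))"
  have s: "0 < s" "s \<le> b" "s \<le> 1" "s \<le> l / (4 * (\<bar>K\<bar> + 1))"
    using b l by (auto simp: s_def)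
  have "l * s - l * s / 2 \<le> l * s - e * (s * (b - s))"
  proof -
    have "e * (s * (b - s)) \<le> e * (s * b)"
      using e s by (intro mult_left_mono) auto
    also have "\<dots> = l * s / 2" using b by (simp add: e_def)
    finally show ?thesis by simp
  qed
  also have "\<dots> \<le> K * s ^ 3" using low[of s] cubic[of s] s by linarith
  also have "\<dots> \<le> (\<bar>K\<bar> + 1) * s * s"
  proof -
    have "s * s * s \<le> s * s" using s by (intro mult_left_le) auto
    then have "K * (s * s * s) \<le> (\<bar>K\<bar> + 1) * (s * s)"
      using s by (intro mult_mono) auto
    then show ?thesis by (simp add: power3_eq_cube mult.assoc)
  qed
  also have "\<dots> \<le> (l / 4) * s"
    using s by (intro mult_right_mono) (auto simp: field_simps)
  finally show False using l s by simp
qed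

section \<open>Hausdorff moment arrays\<close>

text \<open>A moment array stands for \<open>W k l = \<integral> t\<^sup>k (1 - t)\<^sup>l d\<mu>\<close> with a positive measure \<open>\<mu>\<close> on \<open>[0,1]\<close>. If
  \<open>a k = f (k/n)\<close>, then \<open>bernstein_sum W n a\<close> is the \<open>\<mu>\<close>-integral of the \<open>n\<close>-th Bernstein polynomial of \<open>f\<close>.
  The measure itself is never constructed.\<close>

definition moment_array :: "(nat \<Rightarrow> nat \<Rightarrow> real) \<Rightarrow> bool" where
  "moment_array W \<longleftrightarrow> (\<forall>k l. 0 \<le> W k l \<and> W k l = W (Suc k) l + W k (Suc l))"

definition bernstein_sum :: "(nat \<Rightarrow> nat \<Rightarrow> real) \<Rightarrow> nat \<Rightarrow> (nat \<Rightarrow> real) \<Rightarrow> real" where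
  "bernstein_sum W n a = (\<Sum>k\<le>n. real (n choose k) * a k * W k (n - k))"

lemma bernstein_sum_cong:
  "(\<And>k. k \<le> n \<Longrightarrow> a k = b k) \<Longrightarrow> bernstein_sum W n a = bernstein_sum W n b"
  unfolding bernstein_sum_def by (rule sum.cong) auto

lemma bernstein_sum_add:
  "bernstein_sum W n (\<lambda>k. a k + b k) = bernstein_sum W n a + bernstein_sum W n b"
  by (simp add: bernstein_sum_def sum.distrib algebra_simps)

lemma bernstein_sum_diff:
  "bernstein_sum W n (\<lambda>k. a k - b k) = bernstein_sum W n a - bernstein_sum W n b"
  by (simp add: bernstein_sum_def sum_subtractf algebra_simps)

lemma bernstein_sum_scale:
  "bernstein_sum W n (\<lambda>k. c * a k) = c * bernstein_sum W n a"
  by (simp add: bernstein_sum_def sum_distrib_left algebra_simps)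

text \<open>Passing to \<open>W (Suc k) l\<close> multiplies the measure by t, and t times the
  Bernstein basis polynomial of index k and degree n is (k+1)/(n+1) times that of index k+1 and
  degree n+1. At \<open>j = 0\<close> the truncated \<open>j - 1\<close> is harmless, as its factor
  vanishes.\<close>

lemma bernstein_sum_shift_left:
  "bernstein_sum (\<lambda>k l. W (Suc k) l) n a
   = bernstein_sum W (Suc n) (\<lambda>j. real j / real (Suc n) * a (j - 1))"
proof -
  have c: "real (Suc n choose Suc k) * (real (Suc k) / real (Suc n)) = real (n choose k)" for k
  proof -
    have "real (Suc k) * real (Suc n choose Suc k) = real (Suc n) * real (n choose k)"
      by (metis Suc_times_binomial_eq mult.commute of_nat_mult)
    then show ?thesis by (simp add: field_simps del: of_nat_Suc binomial_Suc_Suc)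
  qed
  have "bernstein_sum W (Suc n) (\<lambda>j. real j / real (Suc n) * a (j - 1))
      = (\<Sum>k\<le>n. real (Suc n choose Suc k) * (real (Suc k) / real (Suc n) * a k) * W (Suc k) (n - k))"
    unfolding bernstein_sum_def by (subst sum.atMost_Suc_shift) (simp del: of_nat_Suc binomial_Suc_Suc)
  also have "\<dots> = bernstein_sum (\<lambda>k l. W (Suc k) l) n a"
    unfolding bernstein_sum_def
    by (intro sum.cong refl) (metis c mult.assoc)
  finally show ?thesis by simp
qed

text \<open>The measure is now multiplied by 1 - t; the weight vanishes at the new top index
  \<open>j = Suc n\<close>.\<close>

lemma bernstein_sum_shift_right:
  "bernstein_sum (\<lambda>k l. W k (Suc l)) n a
   = bernstein_sum W (Suc n) (\<lambda>j. (1 - real j / real (Suc n)) * a j)"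
proof -
  have c: "real (Suc n choose k) * (1 - real k / real (Suc n)) = real (n choose k)" if "k \<le> n" for k
  proof -
    have "(Suc n - k) * (Suc n choose k) = Suc n * (n choose k)"
      using binomial_absorb_comp[of "Suc n" k] by simp
    then have "real (Suc n - k) * real (Suc n choose k) = real (Suc n) * real (n choose k)"
      by (metis of_nat_mult)
    moreover have "real (Suc n - k) = real (Suc n) - real k" using that by (simp add: of_nat_diff)
    ultimately show ?thesis by (simp add: field_simps del: of_nat_Suc)
  qed
  have "bernstein_sum W (Suc n) (\<lambda>j. (1 - real j / real (Suc n)) * a j)
      = (\<Sum>k\<le>n. real (Suc n choose k) * ((1 - real k / real (Suc n)) * a k) * W k (Suc n - k))"
    unfolding bernstein_sum_def by (simp del: of_nat_Suc)
  also have "\<dots> = bernstein_sum (\<lambda>k l. W k (Suc l)) n a"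
    unfolding bernstein_sum_def
  proof (intro sum.cong refl)
    fix k assume "k \<in> {..n}"
    then have k: "k \<le> n" by simp
    show "real (Suc n choose k) * ((1 - real k / real (Suc n)) * a k) * W k (Suc n - k)
        = real (n choose k) * a k * W k (Suc (n - k))"
      using c[OF k] k by (simp add: Suc_diff_le mult.assoc[symmetric] del: of_nat_Suc)
  qed
  finally show ?thesis by simp
qed

text \<open>Degree elevation: split 1 = t + (1 - t) under the integral and apply both
  shifts.\<close>

lemma bernstein_sum_elevate:
  assumes "moment_array W"
  shows "bernstein_sum W n a = bernstein_sum W (Suc n)
    (\<lambda>j. real j / real (Suc n) * a (j - 1) + (1 - real j / real (Suc n)) * a j)"
proof -
  have "bernstein_sum W n a = bernstein_sum (\<lambda>k l. W (Suc k) l) n a + bernstein_sum (\<lambda>k l. W k (Suc l)) n a"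
    unfolding bernstein_sum_def sum.distrib[symmetric]
    using assms unfolding moment_array_def by (intro sum.cong refl) (metis distrib_left)
  then show ?thesis
    by (simp only: bernstein_sum_shift_left bernstein_sum_shift_right bernstein_sum_add)
qed

lemma moment_array_nonneg: "moment_array W \<Longrightarrow> 0 \<le> W k l"
  unfolding moment_array_def by blast

lemma bernstein_sum_mono:
  assumes "moment_array W" "\<And>k. k \<le> n \<Longrightarrow> a k \<le> b k"
  shows "bernstein_sum W n a \<le> bernstein_sum W n b"
  unfolding bernstein_sum_def
  by (intro sum_mono mult_right_mono mult_left_mono)
     (use assms in \<open>auto simp: moment_array_nonneg\<close>)

lemma bernstein_sum_const:
  assumes "moment_array W"
  shows "bernstein_sum W n (\<lambda>_. c) = c * W 0 0"
proof (induction n)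
  case 0
  show ?case by (simp add: bernstein_sum_def)
next
  case (Suc n)
  then show ?case
    using bernstein_sum_elevate[OF assms, of n "\<lambda>_. c"] by (simp add: algebra_simps del: of_nat_Suc)
qed

text \<open>Elevation maps the coefficients k/(n+1) of the function t to j/(n+2), so the sum keeps
  its value from degree one.\<close>

lemma bernstein_sum_id:
  assumes "moment_array W"
  shows "bernstein_sum W (Suc n) (\<lambda>k. real k / real (Suc n)) = W 1 0"
proof (induction n)
  case 0
  show ?case by (simp add: bernstein_sum_def)
next
  case (Suc n)
  have "real j / real (Suc (Suc n)) * (real (j - 1) / real (Suc n))
      + (1 - real j / real (Suc (Suc n))) * (real j / real (Suc n)) = real j / real (Suc (Suc n))" for j
    by (cases j) (auto simp: divide_simps, auto simp: algebra_simps)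
  then show ?case
    using bernstein_sum_elevate[OF assms, of "Suc n" "\<lambda>k. real k / real (Suc n)"] Suc
    by (simp del: of_nat_Suc)
qed

lemma bernstein_sum_pos_part_decreasing:
  assumes "moment_array W"
  shows "bernstein_sum W (Suc (Suc n)) (\<lambda>k. max 0 (s - real k / real (Suc (Suc n))))
    \<le> bernstein_sum W (Suc n) (\<lambda>k. max 0 (s - real k / real (Suc n)))"
  unfolding bernstein_sum_elevate[OF assms, of "Suc n"]
proof (rule bernstein_sum_mono[OF assms])
  fix j assume j: "j \<le> Suc (Suc n)"
  define p where "p = real j / real (Suc (Suc n))"
  define u where "u = s - real (j - 1) / real (Suc n)"
  define v where "v = s - real j / real (Suc n)"
  have p: "0 \<le> p" "p \<le> 1" using j by (auto simp: p_def divide_simps)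
  \<comment> \<open>The node \<open>p\<close> is the convex combination, with weights
    \<open>p\<close> and \<open>1 - p\<close>, of two neighbouring nodes of the coarser grid;
    convexity of the positive part does the rest.\<close>
  have "s - p = p * u + (1 - p) * v"
    unfolding p_def u_def v_def
    by (cases j) (auto simp: divide_simps, auto simp: algebra_simps)
  moreover have "p * u \<le> p * max 0 u" "(1 - p) * v \<le> (1 - p) * max 0 v" "0 \<le> p * max 0 u" "0 \<le> (1 - p) * max 0 v"
    using p by (auto intro: mult_left_mono)
  ultimately have "max 0 (s - p) \<le> p * max 0 u + (1 - p) * max 0 v" by linarith
  then show "max 0 (s - real j / real (Suc (Suc n)))
      \<le> real j / real (Suc (Suc n)) * max 0 (s - real (j - 1) / real (Suc n))
        + (1 - real j / real (Suc (Suc n))) * max 0 (s - real j / real (Suc n))"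
    unfolding p_def u_def v_def .
qed

text \<open>The integral of the positive part of \<open>s - t\<close>; the sums converge because the Bernstein
  polynomials of a convex function decrease with the degree.\<close>

definition pos_part_moment :: "(nat \<Rightarrow> nat \<Rightarrow> real) \<Rightarrow> real \<Rightarrow> real" where
  "pos_part_moment W s = lim (\<lambda>n. bernstein_sum W (Suc n) (\<lambda>k. max 0 (s - real k / real (Suc n))))"

lemma pos_part_moment_tendsto:
  assumes "moment_array W"
  shows "(\<lambda>n. bernstein_sum W (Suc n) (\<lambda>k. max 0 (s - real k / real (Suc n))))
    \<longlonglongrightarrow> pos_part_moment W s"
proof -
  let ?f = "\<lambda>n. bernstein_sum W (Suc n) (\<lambda>k. max 0 (s - real k / real (Suc n)))"
  have dec: "decseq ?f"
    unfolding decseq_Suc_iff using bernstein_sum_pos_part_decreasing[OF assms] by blast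
  have "0 \<le> ?f n" for n
    using bernstein_sum_mono[OF assms, of "Suc n" "\<lambda>_. 0" "\<lambda>k. max 0 (s - real k / real (Suc n))"]
      bernstein_sum_const[OF assms, of "Suc n" 0] by simp
  then obtain L where "?f \<longlonglongrightarrow> L"
    using decseq_convergent[OF dec, of 0] by blast
  then have "convergent ?f" by (rule convergentI)
  then show ?thesis
    unfolding pos_part_moment_def by (simp add: convergent_LIMSEQ_iff)
qed

lemma pos_part_moment_nonneg:
  assumes "moment_array W"
  shows "0 \<le> pos_part_moment W s"
proof (rule LIMSEQ_le_const[OF pos_part_moment_tendsto[OF assms]], intro exI allI impI)
  fix n
  show "0 \<le> bernstein_sum W (Suc n) (\<lambda>k. max 0 (s - real k / real (Suc n)))"
    using bernstein_sum_mono[OF assms, of "Suc n" "\<lambda>_. 0" "\<lambda>k. max 0 (s - real k / real (Suc n))"]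
      bernstein_sum_const[OF assms, of "Suc n" 0] by simp
qed

text \<open>The positive part dominates s - t, and Bernstein sums integrate affine functions
  exactly.\<close>

lemma pos_part_moment_lower:
  assumes "moment_array W"
  shows "s * W 0 0 - W 1 0 \<le> pos_part_moment W s"
proof (rule LIMSEQ_le_const[OF pos_part_moment_tendsto[OF assms]], intro exI allI impI)
  fix n
  have "s * W 0 0 - W 1 0 = bernstein_sum W (Suc n) (\<lambda>k. s - real k / real (Suc n))"
    by (simp only: bernstein_sum_diff bernstein_sum_const[OF assms] bernstein_sum_id[OF assms])
  also have "\<dots> \<le> bernstein_sum W (Suc n) (\<lambda>k. max 0 (s - real k / real (Suc n)))"
    by (rule bernstein_sum_mono[OF assms]) simp
  finally show "s * W 0 0 - W 1 0 \<le> \<dots>" .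
qed

lemma pos_part_moment_Lipschitz:
  assumes "moment_array W"
  shows "pos_part_moment W s \<le> pos_part_moment W t + \<bar>s - t\<bar> * W 0 0"
proof (rule LIMSEQ_le[OF pos_part_moment_tendsto[OF assms]
      tendsto_add[OF pos_part_moment_tendsto[OF assms] tendsto_const]], intro exI allI impI)
  fix n
  have "bernstein_sum W (Suc n) (\<lambda>k. max 0 (s - real k / real (Suc n)))
      \<le> bernstein_sum W (Suc n) (\<lambda>k. max 0 (t - real k / real (Suc n)) + \<bar>s - t\<bar>)"
    by (rule bernstein_sum_mono[OF assms]) linarith
  then show "bernstein_sum W (Suc n) (\<lambda>k. max 0 (s - real k / real (Suc n)))
      \<le> bernstein_sum W (Suc n) (\<lambda>k. max 0 (t - real k / real (Suc n))) + \<bar>s - t\<bar> * W 0 0"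
    by (simp only: bernstein_sum_add bernstein_sum_const[OF assms])
qed

lemma continuous_on_pos_part_moment:
  assumes "moment_array W"
  shows "continuous_on S (pos_part_moment W)"
proof -
  have "\<bar>pos_part_moment W s - pos_part_moment W t\<bar> \<le> W 0 0 * \<bar>s - t\<bar>" for s t
    using pos_part_moment_Lipschitz[OF assms, of s t] pos_part_moment_Lipschitz[OF assms, of t s]
    by (simp add: abs_minus_commute abs_le_iff mult.commute)
  then have "(W 0 0)-lipschitz_on S (pos_part_moment W)"
    using assms by (auto intro!: lipschitz_onI simp: dist_real_def moment_array_nonneg)
  then show ?thesis by (rule lipschitz_on_continuous_on)
qed

text \<open>The hypothesis on \<open>W\<close> says \<open>d\<mu>\<^sub>W = (t - s)\<^sup>2 d\<mu>\<^sub>V\<close>, and a tent of height and radius \<open>d\<close> around \<open>s\<close>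
  multiplied by \<open>(t - s)\<^sup>2\<close> is at most \<open>d\<^sup>3\<close>. The coefficients \<open>p\<close>, \<open>q1\<close>, \<open>r\<close> come from raising the Bernstein
  degree by two, which costs the error \<open>2/n\<close>.\<close>

lemma bernstein_sum_tent:
  assumes V: "moment_array V" and s: "0 \<le> s" "s \<le> 1" and d: "0 < d"
    and W: "\<And>k l. W k l = (1 - s)^2 * V (Suc (Suc k)) l - 2 * (s * (1 - s)) * V (Suc k) (Suc l)
                        + s^2 * V k (Suc (Suc l))"
  shows "bernstein_sum W (Suc n) (\<lambda>k. max 0 (d - \<bar>real k / real (Suc n) - s\<bar>))
    \<le> (d^3 + 2 / real (Suc n)) * V 0 0"
proof -
  let ?f = "\<lambda>t. max 0 (d - \<bar>t - s\<bar>)"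
  define m where "m = Suc n"
  define N where "N = Suc (Suc m)"
  define a where "a k = ?f (real k / real m)" for k
  define x where "x j = real j / real N" for j
  define p where "p j = x j * (real (j - 1) / real (Suc m))" for j
  define q1 where "q1 j = x j * (1 - real (j - 1) / real (Suc m))" for j
  define q2 where "q2 j = (1 - x j) * (real j / real (Suc m))" for j
  define r where "r j = (1 - x j) * (1 - real j / real (Suc m))" for j
  have mpos: "real m > 0" "real N > 0" "real (Suc m) > 0" by (auto simp: m_def N_def)
  have "bernstein_sum W m a = (1 - s)^2 * bernstein_sum (\<lambda>k l. V (Suc (Suc k)) l) m a
      - 2 * (s * (1 - s)) * bernstein_sum (\<lambda>k l. V (Suc k) (Suc l)) m a
      + s^2 * bernstein_sum (\<lambda>k l. V k (Suc (Suc l))) m a"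
    unfolding bernstein_sum_def W
    by (simp add: sum_distrib_left sum.distrib sum_subtractf algebra_simps)
  also have "bernstein_sum (\<lambda>k l. V (Suc (Suc k)) l) m a = bernstein_sum V N (\<lambda>j. p j * a (j - 1 - 1))"
    unfolding N_def using bernstein_sum_shift_left[of "\<lambda>k l. V (Suc k) l" m a]
    by (simp only: bernstein_sum_shift_left) (simp add: p_def x_def N_def mult.assoc del: of_nat_Suc)
  also have "bernstein_sum (\<lambda>k l. V (Suc k) (Suc l)) m a = bernstein_sum V N (\<lambda>j. q1 j * a (j - 1))"
    unfolding N_def using bernstein_sum_shift_right[of "\<lambda>k l. V (Suc k) l" m a]
    by (simp only: bernstein_sum_shift_left) (simp add: q1_def x_def N_def mult.assoc del: of_nat_Suc)
  also have "bernstein_sum (\<lambda>k l. V k (Suc (Suc l))) m a = bernstein_sum V N (\<lambda>j. r j * a j)"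
    unfolding N_def using bernstein_sum_shift_right[of "\<lambda>k l. V k (Suc l)" m a]
    by (simp only: bernstein_sum_shift_right) (simp add: r_def x_def N_def mult.assoc del: of_nat_Suc)
  finally have "bernstein_sum W m a = bernstein_sum V N (\<lambda>j. (1 - s)^2 * (p j * a (j - 1 - 1))
      - 2 * (s * (1 - s)) * (q1 j * a (j - 1)) + s^2 * (r j * a j))"
    by (simp only: bernstein_sum_add bernstein_sum_diff bernstein_sum_scale)
  also have "\<dots> \<le> bernstein_sum V N (\<lambda>_. d^3 + 2 / real m)"
  proof (rule bernstein_sum_mono[OF V])
    fix j assume j: "j \<le> N"
    let ?F = "?f (x j)"
    have lip: "?f t \<le> ?f t' + \<bar>t - t'\<bar>" for t t' by (auto simp: max_def)
    have x: "0 \<le> x j" "x j \<le> 1" using j by (auto simp: x_def divide_simps N_def)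
    have pos: "0 \<le> p j" "0 \<le> q1 j" "0 \<le> r j"
    proof -
      show "0 \<le> p j" "0 \<le> q1 j" using x j by (auto simp: p_def q1_def N_def divide_simps)
      show "0 \<le> r j"
      proof (cases "j = N")
        case True then show ?thesis by (simp add: r_def x_def N_def del: of_nat_Suc)
      next
        case False
        then have "real j \<le> real (Suc m)" using j by (simp add: N_def)
        then show ?thesis using x by (simp add: r_def divide_simps del: of_nat_Suc)
      qed
    qed
    \<comment> \<open>The coefficients come from the grid of step \<open>1 / m\<close> but are
      weighted at nodes of step \<open>1 / N\<close>. The tent is 1-Lipschitz, so a shift by at most
      two indices costs at most \<open>2 / m\<close>.\<close>
    have near: "\<bar>real i / real m - x j\<bar> \<le> 2 / real m"
      if "i \<le> j" "real j - real i \<le> 2" "i \<le> m" for i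
    proof -
      have "real i / real m - x j = (2 * real i - real m * (real j - real i)) / (real m * real N)"
        using mpos by (simp add: x_def N_def field_simps)
      moreover have "\<bar>2 * real i - real m * (real j - real i)\<bar> \<le> 2 * real N"
      proof -
        have "0 \<le> real m * (real j - real i)" "real m * (real j - real i) \<le> real m * 2"
          using that by (auto intro: mult_left_mono)
        moreover have "real i \<le> real m" using that by simp
        ultimately show ?thesis by (simp add: N_def abs_le_iff)
      qed
      ultimately have "\<bar>real i / real m - x j\<bar> \<le> 2 * real N / (real m * real N)"
        using mpos by (simp only: abs_divide abs_of_pos mult_pos_pos) (rule divide_right_mono, auto)
      then show ?thesis using mpos by simp
    qed
    \<comment> \<open>The weight \<open>p j\<close> vanishes for \<open>j < 2\<close>, where the
      truncated subtraction does not yield j - 2.\<close>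
    have t1: "p j * a (j - 1 - 1) \<le> p j * (?F + 2 / real m)"
    proof (cases "j < 2")
      case True
      then have "p j = 0" by (auto simp: p_def x_def less_2_cases_iff)
      then show ?thesis by simp
    next
      case False
      then have "real j - real (j - 1 - 1) \<le> 2" "j - 1 - 1 \<le> m" using j by (auto simp: N_def)
      then have "a (j - 1 - 1) \<le> ?F + 2 / real m"
        using near[of "j - 1 - 1"] lip[of "real (j - 1 - 1) / real m" "x j"] by (simp add: a_def)
      then show ?thesis using pos by (intro mult_left_mono) auto
    qed
    \<comment> \<open>The cross term enters with a minus sign, so its comparison goes the opposite
      way.\<close>
    have t2: "q1 j * ?F \<le> q1 j * (a (j - 1) + 2 / real m)"
    proof (cases "j = 0 \<or> j = N")
      case True
      then have "q1 j = 0" by (auto simp: q1_def x_def N_def simp del: of_nat_Suc)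
      then show ?thesis by simp
    next
      case False
      then have "real j - real (j - 1) \<le> 2" "j - 1 \<le> m" using j by (auto simp: N_def)
      then have "?F \<le> a (j - 1) + 2 / real m"
        using near[of "j - 1"] lip[of "x j" "real (j - 1) / real m"]
        by (simp add: a_def abs_minus_commute)
      then show ?thesis using pos by (intro mult_left_mono) auto
    qed
    have t3: "r j * a j \<le> r j * (?F + 2 / real m)"
    proof (cases "j \<le> m")
      case False
      then have "j = Suc m \<or> j = N" using j by (auto simp: N_def)
      then have "r j = 0" by (auto simp: r_def x_def N_def simp del: of_nat_Suc)
      then show ?thesis by simp
    next
      case True
      then have "a j \<le> ?F + 2 / real m"
        using near[of "j"] lip[of "real j / real m" "x j"] by (simp add: a_def)
      then show ?thesis using pos by (intro mult_left_mono) auto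
    qed
    have jx: "real j = x j * real N" using mpos by (simp add: x_def)
    have NM: "real N = real (Suc m) + 1" by (simp add: N_def)
    \<comment> \<open>The common deviation of the elevated weights from x^2, x(1-x) and (1-x)^2. As
      (1-s)x - s(1-x) = x - s, the signed sum of the weights is \<open>(x j - s)^2 - y\<close>, with
      \<open>y\<close> of the favourable sign.\<close>
    define y where "y = x j * (1 - x j) / real (Suc m)"
    have y: "0 \<le> y" using x by (simp add: y_def)
    have pe: "p j = (x j)^2 - y"
    proof (cases "j = 0")
      case True then show ?thesis by (simp add: p_def x_def y_def)
    next
      case False
      then have "real (j - 1) = x j * real N - 1" using jx by (simp add: of_nat_diff)
      then show ?thesis using mpos unfolding p_def y_def NM
        by (simp add: divide_simps del: of_nat_Suc) (simp add: algebra_simps power2_eq_square del: of_nat_Suc)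
    qed
    have qe: "q1 j = x j * (1 - x j) + y"
    proof (cases "j = 0")
      case True then show ?thesis by (simp add: q1_def x_def y_def)
    next
      case False
      then have "real (j - 1) = x j * real N - 1" using jx by (simp add: of_nat_diff)
      then show ?thesis using mpos unfolding q1_def y_def NM
        by (simp add: divide_simps del: of_nat_Suc) (simp add: algebra_simps power2_eq_square del: of_nat_Suc)
    qed
    have re: "r j = (1 - x j)^2 - y"
      using mpos jx unfolding r_def y_def NM
      by (simp add: divide_simps del: of_nat_Suc) (simp add: algebra_simps power2_eq_square del: of_nat_Suc)
    have c: "0 \<le> (1 - s)^2" "0 \<le> 2 * (s * (1 - s))" "0 \<le> s^2" using s by auto
    have "(1 - s)^2 * (p j * a (j - 1 - 1)) - 2 * (s * (1 - s)) * (q1 j * a (j - 1)) + s^2 * (r j * a j)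
       \<le> (1 - s)^2 * (p j * (?F + 2 / real m)) - 2 * (s * (1 - s)) * (q1 j * (?F - 2 / real m))
         + s^2 * (r j * (?F + 2 / real m))"
    proof -
      have "q1 j * (?F - 2 / real m) \<le> q1 j * a (j - 1)" using t2 by (simp add: algebra_simps)
      then show ?thesis
        using mult_left_mono[OF t1 c(1)] mult_left_mono[OF _ c(2)] mult_left_mono[OF t3 c(3)]
        by (smt (verit))
    qed
    also have "\<dots> = ((1 - s)^2 * p j - 2 * (s * (1 - s)) * q1 j + s^2 * r j) * ?F
        + ((1 - s)^2 * p j + 2 * (s * (1 - s)) * q1 j + s^2 * r j) * (2 / real m)"
      by (simp add: algebra_simps)
    also have "(1 - s)^2 * p j - 2 * (s * (1 - s)) * q1 j + s^2 * r j = (x j - s)^2 - y"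
      unfolding pe qe re by (simp add: algebra_simps power2_eq_square)
    also have "((x j - s)^2 - y) * ?F \<le> d^3"
    proof -
      have "((x j - s)^2 - y) * ?F \<le> (x j - s)^2 * ?F"
        using y by (intro mult_right_mono) auto
      also have "\<dots> \<le> d^3"
      proof (cases "\<bar>x j - s\<bar> \<le> d")
        case True
        have "(x j - s)^2 \<le> d^2" using True d by (simp add: power2_le_iff_abs_le)
        moreover have "?F \<le> d" using d by auto
        ultimately have "(x j - s)^2 * ?F \<le> d^2 * d" using d by (intro mult_mono) auto
        then show ?thesis by (simp add: power2_eq_square power3_eq_cube)
      next
        case False
        then have "?F = 0" by auto
        then show ?thesis using d by simp
      qed
      finally show ?thesis .
    qed
    also have "((1 - s)^2 * p j + 2 * (s * (1 - s)) * q1 j + s^2 * r j) * (2 / real m) \<le> 1 * (2 / real m)"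
    proof (rule mult_right_mono)
      have "(1 - s)^2 * p j \<le> 1 * p j" "s^2 * r j \<le> 1 * r j"
        using s by (intro mult_right_mono pos power_le_one; simp)+
      moreover have "2 * (s * (1 - s)) * q1 j \<le> 2 * q1 j"
        using s pos by (intro mult_right_mono) (auto intro: mult_le_one)
      moreover have "p j + 2 * q1 j + r j = 1"
        unfolding pe qe re by (simp add: algebra_simps power2_eq_square)
      ultimately show "(1 - s)^2 * p j + 2 * (s * (1 - s)) * q1 j + s^2 * r j \<le> 1" by linarith
    qed simp
    finally show "(1 - s)^2 * (p j * a (j - 1 - 1)) - 2 * (s * (1 - s)) * (q1 j * a (j - 1)) + s^2 * (r j * a j)
      \<le> d^3 + 2 / real m" by simp
  qed
  also have "\<dots> = (d^3 + 2 / real m) * V 0 0" by (rule bernstein_sum_const[OF V])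
  finally show ?thesis unfolding a_def m_def .
qed

text \<open>The second differences of \<open>pos_part_moment W\<close> are integrals of tents, hence the measure does not
  charge \<open>[0,b)\<close>.\<close>

lemma moment_array_lower_bound:
  assumes W: "moment_array W" and b: "0 < b" "b \<le> 1"
    and V: "\<And>s. 0 \<le> s \<Longrightarrow> s < b \<Longrightarrow> \<exists>V. moment_array V \<and>
      (\<forall>k l. W k l = (1 - s)^2 * V (Suc (Suc k)) l - 2 * (s * (1 - s)) * V (Suc k) (Suc l)
                        + s^2 * V k (Suc (Suc l)))"
  shows "b * W 0 0 \<le> W 1 0"
proof -
  have err: "(\<lambda>n. (d^3 + 2 / real (Suc n)) * c) \<longlonglongrightarrow> d^3 * c" for c d :: real
    using tendsto_mult[OF tendsto_add[OF tendsto_const LIMSEQ_Suc[OF lim_const_over_n[of 2]]] tendsto_const, of "d^3" c]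
    by simp
  have bound: "s * W 0 0 \<le> W 1 0" if s: "0 < s" "s < b" for s
  proof -
    obtain V0 where V0: "moment_array V0"
      "\<And>k l. W k l = (1 - 0)^2 * V0 (Suc (Suc k)) l - 2 * (0 * (1 - 0)) * V0 (Suc k) (Suc l)
                        + 0^2 * V0 k (Suc (Suc l))"
      using V[of 0] b by auto
    have "pos_part_moment W s \<le> 0"
    proof (rule second_difference_vanishing[OF s(1) continuous_on_pos_part_moment[OF W]
            pos_part_moment_nonneg[OF W]])
      fix t :: real assume t: "0 \<le> t" "t \<le> s"
      show "pos_part_moment W t \<le> V0 0 0 * t^3"
      proof (cases "t = 0")
        case True
        have "bernstein_sum W (Suc n) (\<lambda>k. max 0 (0 - real k / real (Suc n))) = 0" for n
          using bernstein_sum_const[OF W, of "Suc n" 0] by (simp add: max_absorb1)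
        then show ?thesis
          using True LIMSEQ_unique[OF pos_part_moment_tendsto[OF W, of 0], of 0] by simp
      next
        case False
        \<comment> \<open>For nodes in [0,1] the tent of radius \<open>t\<close> around 0 is the
          positive part of t - x, so the tent estimate at 0 is the cubic bound.\<close>
        have "bernstein_sum W (Suc n) (\<lambda>k. max 0 (t - real k / real (Suc n)))
            \<le> (t^3 + 2 / real (Suc n)) * V0 0 0" for n
          using bernstein_sum_tent[OF V0(1) _ _ _ V0(2), of t n] t False by simp
        then show ?thesis
          using LIMSEQ_le[OF pos_part_moment_tendsto[OF W, of t] err[of t "V0 0 0"]]
          by (simp add: mult.commute)
      qed
    next
      fix t :: real assume t: "0 < t" "t < s"
      obtain V1 where V1: "moment_array V1"
        "\<And>k l. W k l = (1 - t)^2 * V1 (Suc (Suc k)) l - 2 * (t * (1 - t)) * V1 (Suc k) (Suc l)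
                        + t^2 * V1 k (Suc (Suc l))"
        using V[of t] t s by auto
      have "pos_part_moment W (t + d) + pos_part_moment W (t - d) - 2 * pos_part_moment W t \<le> V1 0 0 * d^3"
        if d: "0 < d" for d
      proof -
        let ?S = "\<lambda>n f. bernstein_sum W (Suc n) (\<lambda>k. f (real k / real (Suc n)))"
        have "?S n (\<lambda>x. max 0 (t + d - x)) + ?S n (\<lambda>x. max 0 (t - d - x)) - 2 * ?S n (\<lambda>x. max 0 (t - x))
            = ?S n (\<lambda>x. max 0 (d - \<bar>x - t\<bar>))" for n
          unfolding bernstein_sum_add[symmetric] bernstein_sum_diff[symmetric] bernstein_sum_scale[symmetric]
          using d by (intro bernstein_sum_cong) (auto simp: max_def)
        then have "?S n (\<lambda>x. max 0 (t + d - x)) + ?S n (\<lambda>x. max 0 (t - d - x)) - 2 * ?S n (\<lambda>x. max 0 (t - x))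
            \<le> (d^3 + 2 / real (Suc n)) * V1 0 0" for n
          using bernstein_sum_tent[OF V1(1) _ _ d V1(2), of n] t s b by simp
        moreover have "(\<lambda>n. ?S n (\<lambda>x. max 0 (t + d - x)) + ?S n (\<lambda>x. max 0 (t - d - x)) - 2 * ?S n (\<lambda>x. max 0 (t - x)))
           \<longlonglongrightarrow> pos_part_moment W (t + d) + pos_part_moment W (t - d) - 2 * pos_part_moment W t"
          by (intro tendsto_intros pos_part_moment_tendsto[OF W])
        ultimately show ?thesis
          using LIMSEQ_le[OF _ err[of d "V1 0 0"]] by (simp add: mult.commute)
      qed
      then show "\<exists>M. \<forall>d>0. d \<le> t \<longrightarrow> t + d \<le> s \<longrightarrow>
          pos_part_moment W (t + d) + pos_part_moment W (t - d) - 2 * pos_part_moment W t \<le> M * d ^ 3"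
        by blast
    qed
    then show ?thesis using pos_part_moment_lower[OF W, of s] by simp
  qed
  \<comment> \<open>The shifts are available only below \<open>b\<close>, so s increases to
    \<open>b\<close> in the limit.\<close>
  show ?thesis
  proof (rule tendsto_upperbound)
    show "((\<lambda>s. s * W 0 0) \<longlongrightarrow> b * W 0 0) (at_left b)" by (intro tendsto_intros)
    show "\<forall>\<^sub>F s in at_left b. s * W 0 0 \<le> W 1 0"
      unfolding eventually_at_left[OF b(1)] using bound b(1) by blast
    show "at_left b \<noteq> bot" by simp
  qed
qed

section \<open>Positive sesquilinear forms\<close>

locale positive_form = vector_space scale
  for scale :: "complex \<Rightarrow> 'e::ab_group_add \<Rightarrow> 'e" +
  fixes h :: "'e \<Rightarrow> 'e \<Rightarrow> complex"
  assumes form_add_left: "h (x + y) z = h x z + h y z"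
    and form_scale_left: "h (scale c x) z = c * h x z"
    and form_add_right: "h x (y + z) = h x y + h x z"
    and form_scale_right: "h x (scale c y) = cnj c * h x y"
    and form_nonneg: "h x x \<in> \<real>\<^sub>\<ge>\<^sub>0"
begin

lemma form_minus_left: "h (- x) z = - h x z"
  using form_scale_left[of "-1" x z] by simp

lemma form_minus_right: "h x (- z) = - h x z"
  using form_scale_right[of x "-1" z] by simp

lemma form_diff_left: "h (x - y) z = h x z - h y z"
  using form_add_left[of x "- y" z] by (simp add: form_minus_left)

lemma form_diff_right: "h x (y - z) = h x y - h x z"
  using form_add_right[of x y "- z"] by (simp add: form_minus_right)

lemmas form_simps = form_add_left form_add_right form_diff_left form_diff_right
  form_scale_left form_scale_right

definition sqn :: "'e \<Rightarrow> real" where "sqn x = Re (h x x)"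

lemma sqn_nonneg: "0 \<le> sqn x"
  using form_nonneg[of x] by (simp add: sqn_def complex_nonneg_Reals_iff)

lemma form_self: "h x x = complex_of_real (sqn x)"
  using form_nonneg[of x] by (simp add: sqn_def complex_nonneg_Reals_iff complex_eq_iff)

text \<open>The diagonal is real; expanding it at x + y and at x + iy gives the imaginary and the
  real part.\<close>

lemma form_cnj: "h y x = cnj (h x y)"
proof -
  have im: "Im (h z z) = 0" for z by (simp add: form_self)
  have "Im (h x y) + Im (h y x) = 0"
    using im[of "x + y"] by (simp add: form_simps im)
  moreover have "Re (h y x) - Re (h x y) = 0"
    using im[of "x + scale \<i> y"] by (simp add: form_simps im)
  ultimately show ?thesis by (simp add: complex_eq_iff)
qed

lemma sqn_diff: "sqn (x - y) = sqn x - 2 * Re (h x y) + sqn y"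
  using form_cnj[of x y] by (simp add: sqn_def form_simps)

lemma sqn_add: "sqn (x + y) = sqn x + 2 * Re (h x y) + sqn y"
  using form_cnj[of x y] by (simp add: sqn_def form_simps)

lemma sqn_scale: "sqn (scale c x) = (cmod c)^2 * sqn x"
proof -
  have "h (scale c x) (scale c x) = (c * cnj c) * h x x" by (simp add: form_simps)
  then show ?thesis by (simp add: sqn_def complex_norm_square[symmetric])
qed

lemma parallelogram: "sqn (x + y) + sqn (x - y) = 2 * sqn x + 2 * sqn y"
  by (simp add: sqn_add sqn_diff)

lemma Cauchy_Schwarz: "(cmod (h x y))^2 \<le> sqn x * sqn y"
proof -
  define a where "a = h x y"
  \<comment> \<open>Two parameters avoid a division: \<open>r = sqn y\<close>, \<open>t = 1\<close>
    give the residual of the projection, scaled by \<open>sqn y\<close>. If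
    \<open>sqn y = 0\<close>, then for \<open>r = 1\<close> the expression is affine in
    \<open>t\<close> and stays nonnegative only if \<open>a = 0\<close>.\<close>
  have expand: "sqn (scale (complex_of_real r) x - scale (complex_of_real t * a) y)
      = r^2 * sqn x - 2 * r * t * (cmod a)^2 + t^2 * (cmod a)^2 * sqn y" for r t
  proof -
    have "h (scale (complex_of_real r) x) (scale (complex_of_real t * a) y)
        = complex_of_real (r * t) * (a * cnj a)"
      by (simp add: form_simps a_def)
    then show ?thesis
      by (simp add: sqn_diff sqn_scale complex_norm_square[symmetric] norm_mult power_mult_distrib)
  qed
  show ?thesis
  proof (cases "sqn y = 0")
    case True
    have "0 \<le> sqn x - 2 * t * (cmod a)^2" for t
      using expand[of 1 t] sqn_nonneg[of "scale (complex_of_real 1) x - scale (complex_of_real t * a) y"] True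
      by simp
    from this[of "(sqn x + 1) / (2 * (cmod a)^2)"] have "cmod a = 0"
      by (cases "cmod a = 0") auto
    then show ?thesis using True by (simp add: a_def)
  next
    case False
    then have pos: "0 < sqn y" using sqn_nonneg[of y] by simp
    have "0 \<le> sqn y * (sqn y * sqn x - (cmod a)^2)"
      using expand[of "sqn y" 1]
        sqn_nonneg[of "scale (complex_of_real (sqn y)) x - scale (complex_of_real 1 * a) y"]
      by (simp add: algebra_simps power2_eq_square)
    then show ?thesis using pos by (simp add: zero_le_mult_iff a_def mult.commute)
  qed
qed

lemma cmod_form_le: "cmod (h x y) \<le> sqrt (sqn x) * sqrt (sqn y)"
  using Cauchy_Schwarz[of x y] by (metis real_le_rsqrt real_sqrt_mult)

lemma form_tendsto:
  assumes "(\<lambda>n. sqn (u n - x)) \<longlonglongrightarrow> 0"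
  shows "(\<lambda>n. h (u n) y) \<longlonglongrightarrow> h x y" "(\<lambda>n. h y (u n)) \<longlonglongrightarrow> h y x"
proof -
  have "(\<lambda>n. sqrt (sqn (u n - x)) * sqrt (sqn y)) \<longlonglongrightarrow> sqrt 0 * sqrt (sqn y)"
    using assms by (intro tendsto_intros)
  then have lim: "(\<lambda>n. sqrt (sqn (u n - x)) * sqrt (sqn y)) \<longlonglongrightarrow> 0" by simp
  have "(\<lambda>n. h (u n - x) y) \<longlonglongrightarrow> 0"
    by (rule Lim_null_comparison[OF always_eventually lim]) (simp add: cmod_form_le)
  then have "(\<lambda>n. h (u n) y - h x y) \<longlonglongrightarrow> 0" by (simp add: form_diff_left)
  then show "(\<lambda>n. h (u n) y) \<longlonglongrightarrow> h x y" by (rule LIM_zero_cancel)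
  from tendsto_cnj[OF this] show "(\<lambda>n. h y (u n)) \<longlonglongrightarrow> h y x"
    by (simp only: form_cnj[symmetric])
qed

lemma sqn_tendsto:
  assumes "(\<lambda>n. sqn (u n - x)) \<longlonglongrightarrow> 0"
  shows "(\<lambda>n. sqn (u n)) \<longlonglongrightarrow> sqn x"
proof -
  have "(\<lambda>n. sqn (u n - x) + 2 * Re (h (u n) x) - sqn x) \<longlonglongrightarrow> 0 + 2 * Re (h x x) - sqn x"
    by (intro tendsto_intros form_tendsto assms)
  then show ?thesis by (simp only: sqn_diff) (simp add: sqn_def)
qed

definition linear_on :: "'e set \<Rightarrow> ('e \<Rightarrow> 'e) \<Rightarrow> bool" where
  "linear_on D G \<longleftrightarrow> G ` D \<subseteq> D \<and> (\<forall>x\<in>D. \<forall>y\<in>D. G (x + y) = G x + G y)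
     \<and> (\<forall>c. \<forall>x\<in>D. G (scale c x) = scale c (G x))"

section \<open>Approximate orthogonal projections\<close>

text \<open>Sequences in \<open>D\<close> approximating the projection of \<open>y\<close> onto the completion of \<open>D\<close>.\<close>

definition projection_seq :: "'e set \<Rightarrow> 'e \<Rightarrow> (nat \<Rightarrow> 'e) \<Rightarrow> bool" where
  "projection_seq D y u \<longleftrightarrow> (\<forall>n. u n \<in> D) \<and> (\<forall>x\<in>D. (\<lambda>n. h (u n - y) x) \<longlonglongrightarrow> 0)
     \<and> (\<exists>K. \<forall>n. sqn (u n - y) \<le> K) \<and> (\<forall>e>0. \<exists>N. \<forall>m\<ge>N. \<forall>n\<ge>N. sqn (u m - u n) < e)"

lemma sqn_add_le: "sqn (x + y) \<le> 2 * sqn x + 2 * sqn y"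
  using parallelogram[of x y] sqn_nonneg[of "x - y"] by linarith

lemma projection_seq_add:
  assumes "subspace D" "projection_seq D y u" "projection_seq D z v"
  shows "projection_seq D (y + z) (\<lambda>n. u n + v n)"
  unfolding projection_seq_def
proof (intro conjI allI ballI impI)
  show "u n + v n \<in> D" for n
    using assms subspace_add unfolding projection_seq_def by blast
next
  fix x assume "x \<in> D"
  then have "(\<lambda>n. h (u n - y) x + h (v n - z) x) \<longlonglongrightarrow> 0 + 0"
    using assms unfolding projection_seq_def by (intro tendsto_add) blast+
  then show "(\<lambda>n. h (u n + v n - (y + z)) x) \<longlonglongrightarrow> 0"
    by (simp add: form_simps algebra_simps)
next
  obtain K L where "\<And>n. sqn (u n - y) \<le> K" "\<And>n. sqn (v n - z) \<le> L"
    using assms unfolding projection_seq_def by blast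
  moreover have "sqn (u n + v n - (y + z)) \<le> 2 * sqn (u n - y) + 2 * sqn (v n - z)" for n
    using sqn_add_le[of "u n - y" "v n - z"] by (simp add: algebra_simps)
  ultimately show "\<exists>K. \<forall>n. sqn (u n + v n - (y + z)) \<le> K"
    by (intro exI[of _ "2 * K + 2 * L"]) (smt (verit))
next
  fix e :: real assume "0 < e"
  then have "0 < e / 4" by simp
  then obtain M N where M: "\<forall>m\<ge>M. \<forall>n\<ge>M. sqn (u m - u n) < e / 4"
      and N: "\<forall>m\<ge>N. \<forall>n\<ge>N. sqn (v m - v n) < e / 4"
    using assms unfolding projection_seq_def by meson
  have "sqn (u m + v m - (u n + v n)) < e" if "m \<ge> max M N" "n \<ge> max M N" for m n
  proof -
    have "sqn (u m - u n) < e / 4" "sqn (v m - v n) < e / 4" using M N that by auto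
    then show ?thesis
      using sqn_add_le[of "u m - u n" "v m - v n"] by (simp add: algebra_simps)
  qed
  then show "\<exists>N. \<forall>m\<ge>N. \<forall>n\<ge>N. sqn (u m + v m - (u n + v n)) < e" by blast
qed

lemma projection_seq_scale:
  assumes "subspace D" "projection_seq D y u"
  shows "projection_seq D (scale c y) (\<lambda>n. scale c (u n))"
  unfolding projection_seq_def scale_right_diff_distrib[symmetric] sqn_scale form_scale_left
proof (intro conjI allI ballI impI)
  show "scale c (u n) \<in> D" for n
    using assms subspace_scale unfolding projection_seq_def by blast
next
  fix x assume "x \<in> D"
  then have "(\<lambda>n. c * h (u n - y) x) \<longlonglongrightarrow> c * 0"
    using assms unfolding projection_seq_def by (intro tendsto_mult_left) blast+
  then show "(\<lambda>n. c * h (u n - y) x) \<longlonglongrightarrow> 0" by simp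
next
  obtain K where "\<And>n. sqn (u n - y) \<le> K"
    using assms unfolding projection_seq_def by blast
  then show "\<exists>K. \<forall>n. (cmod c)^2 * sqn (u n - y) \<le> K"
    by (intro exI[of _ "(cmod c)^2 * K"]) (simp add: mult_left_mono)
next
  fix e :: real assume "0 < e"
  then have "0 < e / ((cmod c)^2 + 1)" by (simp add: add_nonneg_pos)
  then obtain N where N: "\<forall>m\<ge>N. \<forall>n\<ge>N. sqn (u m - u n) < e / ((cmod c)^2 + 1)"
    using assms unfolding projection_seq_def by meson
  have "(cmod c)^2 * sqn (u m - u n) < e" if "m \<ge> N" "n \<ge> N" for m n
  proof -
    have "(cmod c)^2 * sqn (u m - u n) \<le> ((cmod c)^2 + 1) * sqn (u m - u n)"
      using sqn_nonneg by (intro mult_right_mono) auto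
    also have "\<dots> < e" using N that by (simp add: pos_less_divide_eq add_nonneg_pos mult.commute)
    finally show ?thesis .
  qed
  then show "\<exists>N. \<forall>m\<ge>N. \<forall>n\<ge>N. (cmod c)^2 * sqn (u m - u n) < e" by blast
qed

lemma sqn_zero: "sqn 0 = 0"
  using sqn_scale[of 0 0] by simp

lemma form_zero_left: "h 0 x = 0"
  using form_scale_left[of 0 0 x] by simp

lemma projection_seq_const: "x \<in> D \<Longrightarrow> projection_seq D x (\<lambda>_. x)"
  unfolding projection_seq_def by (auto simp: sqn_zero form_zero_left)

text \<open>Orthogonality is given only against fixed vectors of \<open>D\<close>. Freezing the test
  vector at a late \<open>u N\<close> costs, by Cauchy-Schwarz, a bounded residual times a small
  distance.\<close>

lemma projection_seq_form_self:
  assumes "projection_seq D y u"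
  shows "(\<lambda>n. h (u n - y) (u n)) \<longlonglongrightarrow> 0"
proof (rule LIMSEQ_I)
  fix r :: real assume r: "0 < r"
  obtain K where K: "\<And>n. sqn (u n - y) \<le> K"
    using assms unfolding projection_seq_def by blast
  then have K0: "0 \<le> K" using sqn_nonneg order_trans by blast
  define e where "e = (r / 2)^2 / (K + 1)"
  have "0 < e" using r K0 by (simp add: e_def)
  then obtain N where N: "\<And>m n. N \<le> m \<Longrightarrow> N \<le> n \<Longrightarrow> sqn (u m - u n) < e"
    using assms unfolding projection_seq_def by meson
  have lim: "(\<lambda>n. h (u n - y) (u N)) \<longlonglongrightarrow> 0"
    using assms unfolding projection_seq_def by blast
  obtain M where M: "\<And>n. M \<le> n \<Longrightarrow> norm (h (u n - y) (u N)) < r / 2"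
    using LIMSEQ_D[OF lim half_gt_zero[OF r]] by auto
  have "norm (h (u n - y) (u n) - 0) < r" if n: "n \<ge> max M N" for n
  proof -
    have "(cmod (h (u n - y) (u n - u N)))^2 \<le> sqn (u n - y) * sqn (u n - u N)"
      by (rule Cauchy_Schwarz)
    also have "\<dots> \<le> (K + 1) * e"
      using K[of n] N[of n N] n K0 by (intro mult_mono) (auto simp: sqn_nonneg less_imp_le add_increasing2)
    also have "\<dots> = (r / 2)^2" using K0 by (simp add: e_def)
    finally have "cmod (h (u n - y) (u n - u N)) \<le> r / 2"
      using r by (simp add: power2_le_iff_abs_le)
    moreover have "h (u n - y) (u n) = h (u n - y) (u n - u N) + h (u n - y) (u N)"
      by (simp add: form_diff_right)
    ultimately show ?thesis
      using M[of n] n norm_triangle_ineq[of "h (u n - y) (u n - u N)" "h (u n - y) (u N)"] by simp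
  qed
  then show "\<exists>no. \<forall>n\<ge>no. norm (h (u n - y) (u n) - 0) < r" by blast
qed

text \<open>The difference is a projection sequence of 0, and by the previous limit its seminorm
  tends to 0.\<close>

lemma projection_seq_unique:
  assumes D: "subspace D" and u: "projection_seq D y u" and v: "projection_seq D y v"
  shows "(\<lambda>n. h (u n) z - h (v n) z) \<longlonglongrightarrow> 0"
proof -
  have "projection_seq D 0 (\<lambda>n. u n - v n)"
    using projection_seq_add[OF D u projection_seq_scale[OF D v, of "-1"]] by simp
  from projection_seq_form_self[OF this] have "(\<lambda>n. h (u n - v n) (u n - v n)) \<longlonglongrightarrow> 0" by simp
  from tendsto_Re[OF this] have "(\<lambda>n. sqn (u n - v n)) \<longlonglongrightarrow> 0" by (simp add: sqn_def)
  then have "(\<lambda>n. h (u n - v n) z) \<longlonglongrightarrow> h 0 z"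
    by (intro form_tendsto) simp
  then show ?thesis by (simp add: form_zero_left form_diff_left)
qed

text \<open>Take a minimizing sequence for the distance to \<open>D\<close>: perturbing along
  \<open>x\<close> gives asymptotic orthogonality, and the parallelogram law at midpoints gives the
  Cauchy property.\<close>

lemma projection_seq_exists:
  assumes D: "subspace D"
  shows "\<exists>u. projection_seq D y u"
proof -
  define \<delta> where "\<delta> = Inf ((\<lambda>x. sqn (x - y)) ` D)"
  have bdd: "bdd_below ((\<lambda>x. sqn (x - y)) ` D)"
    by (rule bdd_belowI[of _ 0]) (auto simp: sqn_nonneg)
  have ne: "(\<lambda>x. sqn (x - y)) ` D \<noteq> {}" using subspace_0[OF D] by blast
  have low: "\<delta> \<le> sqn (x - y)" if "x \<in> D" for x
    unfolding \<delta>_def by (rule cInf_lower[OF _ bdd]) (use that in auto)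
  have "\<exists>x\<in>D. sqn (x - y) < \<delta> + 1 / real (Suc n)" for n
    using cInf_lessD[OF ne, of "\<delta> + 1 / real (Suc n)"] by (auto simp: \<delta>_def)
  then obtain u where u: "\<And>n. u n \<in> D" "\<And>n. sqn (u n - y) < \<delta> + 1 / real (Suc n)"
    by metis
  have err: "(\<lambda>n. c * (1 / real (Suc n))) \<longlonglongrightarrow> 0" for c
    using tendsto_mult_left[OF LIMSEQ_Suc[OF lim_const_over_n[of "1::real"]], of c] by simp
  have "projection_seq D y u"
    unfolding projection_seq_def
  proof (intro conjI allI ballI impI)
    show "u n \<in> D" for n by fact
  next
    fix x assume x: "x \<in> D"
    have bound: "(cmod (h (u n - y) x))^2 \<le> (sqn x + 1) * (1 / real (Suc n))" for n
    proof -
      define a where "a = h (u n - y) x"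
      \<comment> \<open>A step length with \<open>t * sqn x \<le> 1\<close>, also defined when
        \<open>x\<close> has seminorm 0.\<close>
      define t where "t = 1 / (sqn x + 1)"
      have q: "0 < sqn x + 1" using sqn_nonneg[of x] by simp
      have "u n - scale (complex_of_real t * a) x \<in> D"
        using u x D by (intro subspace_diff subspace_scale) auto
      from low[OF this] have "\<delta> \<le> sqn ((u n - y) - scale (complex_of_real t * a) x)"
        by (simp add: algebra_simps)
      also have "\<dots> = sqn (u n - y) - 2 * t * (cmod a)^2 + t^2 * (cmod a)^2 * sqn x"
      proof -
        have "h (u n - y) (scale (complex_of_real t * a) x) = complex_of_real t * (a * cnj a)"
          by (simp add: form_scale_right a_def)
        then show ?thesis
          by (simp add: sqn_diff sqn_scale complex_norm_square[symmetric] norm_mult power_mult_distrib)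
      qed
      finally have "2 * t * (cmod a)^2 - t^2 * (cmod a)^2 * sqn x \<le> 1 / real (Suc n)"
        using u(2)[of n] by linarith
      moreover have "t * (cmod a)^2 \<le> 2 * t * (cmod a)^2 - t^2 * (cmod a)^2 * sqn x"
      proof -
        have "t * sqn x \<le> 1" using q by (simp add: t_def)
        then have "(t * (cmod a)^2) * (t * sqn x) \<le> (t * (cmod a)^2) * 1"
          using q by (intro mult_left_mono) (auto simp: t_def)
        then show ?thesis by (simp add: power2_eq_square mult_ac)
      qed
      ultimately have "t * (cmod a)^2 \<le> 1 / real (Suc n)" by linarith
      then show ?thesis using q by (simp add: t_def a_def field_simps)
    qed
    have "(\<lambda>n. (cmod (h (u n - y) x))^2) \<longlonglongrightarrow> 0"
      by (rule Lim_null_comparison[OF always_eventually err[of "sqn x + 1"]]) (use bound in simp)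
    then have "(\<lambda>n. sqrt ((cmod (h (u n - y) x))^2)) \<longlonglongrightarrow> sqrt 0" by (rule tendsto_real_sqrt)
    then show "(\<lambda>n. h (u n - y) x) \<longlonglongrightarrow> 0" by (simp add: tendsto_norm_zero_iff)
  next
    show "\<exists>K. \<forall>n. sqn (u n - y) \<le> K"
    proof (intro exI allI)
      fix n
      have "1 / real (Suc n) \<le> 1" by simp
      then show "sqn (u n - y) \<le> \<delta> + 1" using u(2)[of n] by linarith
    qed
  next
    fix e :: real assume e: "0 < e"
    obtain N where N: "1 / real (Suc N) < e / 4"
      using e reals_Archimedean[of "e / 4"] by (auto simp: inverse_eq_divide)
    have "sqn (u m - u n) < e" if "m \<ge> N" "n \<ge> N" for m n
    proof -
      have near: "sqn (u k - y) < \<delta> + e / 4" if "k \<ge> N" for k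
      proof -
        have "1 / real (Suc k) \<le> 1 / real (Suc N)" using that by (simp add: frac_le)
        then show ?thesis using u(2)[of k] N by linarith
      qed
      have "scale (1/2) (u m + u n) \<in> D" using u D by (intro subspace_scale subspace_add) auto
      from low[OF this] have "4 * \<delta> \<le> 4 * sqn (scale (1/2) (u m + u n) - y)" by simp
      also have "\<dots> = sqn (scale 2 (scale (1/2) (u m + u n) - y))" by (simp add: sqn_scale)
      also have "scale 2 (scale (1/2) (u m + u n) - y) = (u m - y) + (u n - y)"
        using scale_left_distrib[of 1 1 y] by (simp add: scale_right_diff_distrib)
      finally have "4 * \<delta> + sqn (u m - u n) \<le> 2 * sqn (u m - y) + 2 * sqn (u n - y)"
        using parallelogram[of "u m - y" "u n - y"] by simp
      then show ?thesis using near[OF that(1)] near[OF that(2)] by linarith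
    qed
    then show "\<exists>N. \<forall>m\<ge>N. \<forall>n\<ge>N. sqn (u m - u n) < e" by blast
  qed
  then show ?thesis by blast
qed

section \<open>Operators on a subspace and their moments\<close>

lemma linear_on_mem: "linear_on D G \<Longrightarrow> x \<in> D \<Longrightarrow> G x \<in> D"
  by (auto simp: linear_on_def)

lemma linear_on_diff:
  assumes "subspace D" "linear_on D G" "x \<in> D" "y \<in> D"
  shows "G (x - y) = G x - G y"
proof -
  have "G (x + scale (-1) y) = G x + scale (-1) (G y)"
    using assms subspace_scale[of D y "-1"] unfolding linear_on_def by metis
  then show ?thesis by simp
qed

lemma linear_on_funpow: "linear_on D G \<Longrightarrow> linear_on D (G ^^ n)"
  by (induction n) (auto simp: linear_on_def image_subset_iff)

lemma linear_on_compose: "linear_on D G \<Longrightarrow> linear_on D H \<Longrightarrow> linear_on D (\<lambda>x. G (H x))"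
  by (auto simp: linear_on_def image_subset_iff)

context
  fixes D :: "'e set" and T :: "'e \<Rightarrow> 'e"
  assumes D: "subspace D" and T: "linear_on D T"
    and T_sym: "\<And>x y. x \<in> D \<Longrightarrow> y \<in> D \<Longrightarrow> h (T x) y = h x (T y)"
    and T_nonneg: "\<And>x. x \<in> D \<Longrightarrow> 0 \<le> Re (h (T x) x)"
    and T_le: "\<And>x. x \<in> D \<Longrightarrow> Re (h (T x) x) \<le> sqn x"
begin

definition compl_op :: "'e \<Rightarrow> 'e" where "compl_op x = x - T x"

definition op_moment :: "'e \<Rightarrow> nat \<Rightarrow> nat \<Rightarrow> real" where
  "op_moment x k l = Re (h ((T ^^ k) ((compl_op ^^ l) x)) x)"

lemma linear_on_compl_op: "linear_on D compl_op"
  using T D unfolding linear_on_def compl_op_def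
  by (auto simp: algebra_simps subspace_diff image_subset_iff)

lemma word_linear: "linear_on D (\<lambda>x. (T ^^ k) ((compl_op ^^ l) x))"
  by (rule linear_on_compose[OF linear_on_funpow[OF T] linear_on_funpow[OF linear_on_compl_op]])

lemma compl_op_commute: "x \<in> D \<Longrightarrow> compl_op (T x) = T (compl_op x)"
  using linear_on_diff[OF D T, of x "T x"] linear_on_mem[OF T]
  by (simp add: compl_op_def)

lemma word_T:
  assumes "x \<in> D"
  shows "(T ^^ k) ((compl_op ^^ l) (T x)) = T ((T ^^ k) ((compl_op ^^ l) x))"
proof -
  have "(compl_op ^^ l) (T x) = T ((compl_op ^^ l) x)"
  proof (induction l)
    case (Suc l)
    then show ?case
      using compl_op_commute[of "(compl_op ^^ l) x"] assms
        linear_on_mem[OF linear_on_funpow[OF linear_on_compl_op]] by simp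
  qed simp
  then show ?thesis by (simp add: funpow_swap1)
qed

lemma word_compl_op:
  assumes "x \<in> D"
  shows "(T ^^ k) ((compl_op ^^ l) (compl_op x)) = compl_op ((T ^^ k) ((compl_op ^^ l) x))"
  using word_T[OF assms, of k l] assms
  unfolding compl_op_def[of x] compl_op_def[of "(T ^^ k) ((compl_op ^^ l) x)"]
  by (subst linear_on_diff[OF D word_linear]) (simp_all add: linear_on_mem[OF T])

lemma compl_op_sym: "x \<in> D \<Longrightarrow> y \<in> D \<Longrightarrow> h (compl_op x) y = h x (compl_op y)"
  by (simp add: compl_op_def form_diff_left form_diff_right T_sym)

lemma op_moment_Suc:
  assumes "x \<in> D"
  shows "op_moment x k l = op_moment x (Suc k) l + op_moment x k (Suc l)"
proof -
  have "(T ^^ k) ((compl_op ^^ Suc l) x) = compl_op ((T ^^ k) ((compl_op ^^ l) x))"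
    using word_compl_op[OF assms] by (simp add: funpow_swap1)
  then show ?thesis
    by (simp add: op_moment_def compl_op_def[of "(T ^^ k) ((compl_op ^^ l) x)"] form_diff_left)
qed

text \<open>One extra \<open>T\<close> comes from the first slot; the other is moved there from the
  second by symmetry.\<close>

lemma op_moment_T:
  assumes "x \<in> D"
  shows "op_moment (T x) k l = op_moment x (Suc (Suc k)) l"
  using assms T_sym[of "(T ^^ k) ((compl_op ^^ l) (T x))" x] linear_on_mem[OF word_linear]
  by (simp add: op_moment_def word_T linear_on_mem[OF T])

lemma op_moment_compl_op:
  assumes "x \<in> D"
  shows "op_moment (compl_op x) k l = op_moment x k (Suc (Suc l))"
proof -
  let ?w = "(T ^^ k) ((compl_op ^^ l) x)"
  have w: "?w \<in> D" using assms by (rule linear_on_mem[OF word_linear])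
  have c: "compl_op z \<in> D" if "z \<in> D" for z using that by (rule linear_on_mem[OF linear_on_compl_op])
  have "(T ^^ k) ((compl_op ^^ Suc (Suc l)) x) = (T ^^ k) ((compl_op ^^ l) (compl_op (compl_op x)))"
    by (simp add: funpow_swap1)
  also have "\<dots> = compl_op (compl_op ?w)"
    using assms c by (simp add: word_compl_op)
  finally show ?thesis
    using compl_op_sym[OF c[OF w] assms] assms by (simp add: op_moment_def word_compl_op)
qed

text \<open>No square roots are taken: factors are absorbed into the vector in pairs until both
  exponents are below two. The mixed case rests on T(1 - T) = T^2 (1 - T) + T (1 - T)^2.\<close>

lemma op_moment_nonneg: "x \<in> D \<Longrightarrow> 0 \<le> op_moment x k l"
proof (induction "k + l" arbitrary: k l x rule: less_induct)
  case less
  have Tx: "T x \<in> D" and Qx: "compl_op x \<in> D"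
    using less.prems linear_on_mem[OF T] linear_on_mem[OF linear_on_compl_op] by auto
  have base: "0 \<le> op_moment y 1 0" "0 \<le> op_moment y 0 1" if "y \<in> D" for y
    using T_nonneg[OF that] T_le[OF that]
    by (simp_all add: op_moment_def compl_op_def form_diff_left sqn_def)
  consider (T2) k' where "k = Suc (Suc k')" | (Q2) l' where "l = Suc (Suc l')"
    | (small) "k < 2" "l < 2"
    by (metis add_2_eq_Suc less_eqE not_less)
  then show ?case
  proof cases
    case T2
    then show ?thesis using less.hyps[of k' l "T x"] Tx op_moment_T[OF less.prems] by simp
  next
    case Q2
    then show ?thesis using less.hyps[of k l' "compl_op x"] Qx op_moment_compl_op[OF less.prems] by simp
  next
    case small
    have "op_moment x 1 1 = op_moment (T x) 0 1 + op_moment (compl_op x) 1 0"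
    proof -
      have "op_moment x 1 1 = op_moment x 2 1 + op_moment x 1 2"
        using op_moment_Suc[OF less.prems, of 1 1] by (simp add: numeral_2_eq_2)
      then show ?thesis
        using op_moment_T[OF less.prems, of 0 1] op_moment_compl_op[OF less.prems, of 1 0]
        by (simp add: numeral_2_eq_2)
    qed
    then have "0 \<le> op_moment x 1 1"
      using base[OF Tx] base[OF Qx] by simp
    moreover have "0 \<le> op_moment x 0 0" by (simp add: op_moment_def sqn_nonneg sqn_def[symmetric])
    ultimately show ?thesis using small base[OF less.prems]
      by (auto simp: less_2_cases_iff)
  qed
qed

lemma moment_array_op_moment: "x \<in> D \<Longrightarrow> moment_array (op_moment x)"
  unfolding moment_array_def using op_moment_nonneg op_moment_Suc by blast

text \<open>Write T - s = (1 - s) T - s (1 - T) and expand: the squares add two factors of one kind,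
  the cross terms one of each.\<close>

lemma op_moment_shifted:
  fixes s :: real
  assumes u: "u \<in> D" and x: "x = T u - scale (complex_of_real s) u"
  shows "op_moment x k l = (1 - s)^2 * op_moment u (Suc (Suc k)) l
     - 2 * (s * (1 - s)) * op_moment u (Suc k) (Suc l) + s^2 * op_moment u k (Suc (Suc l))"
proof -
  let ?w = "\<lambda>z. (T ^^ k) ((compl_op ^^ l) z)"
  let ?a = "complex_of_real (1 - s)" and ?b = "complex_of_real s"
  let ?y = "T u" and ?z = "compl_op u"
  have y: "?y \<in> D" and z: "?z \<in> D"
    using u linear_on_mem[OF T] linear_on_mem[OF linear_on_compl_op] by auto
  have xe: "x = scale ?a ?y - scale ?b ?z"
    unfolding x compl_op_def by (simp add: scale_right_diff_distrib scale_left_diff_distrib)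
  have wx: "?w x = scale ?a (?w ?y) - scale ?b (?w ?z)"
    unfolding xe using word_linear[of k l] y z D
    by (subst linear_on_diff[OF D word_linear]) (auto simp: linear_on_def subspace_scale)
  have cross: "Re (h (?w ?y) ?z) = op_moment u (Suc k) (Suc l)"
    using compl_op_sym[OF linear_on_mem[OF word_linear y] u, of k l] word_compl_op[OF y, of k l]
      compl_op_commute[OF u] word_T[OF z, of k l]
    by (simp add: op_moment_def funpow_swap1)
  have cross': "Re (h (?w ?z) ?y) = op_moment u (Suc k) (Suc l)"
    using T_sym[OF linear_on_mem[OF word_linear z] u, of k l]
    by (simp add: op_moment_def funpow_swap1)
  have "op_moment x k l = (1 - s)^2 * Re (h (?w ?y) ?y) - s * (1 - s) * Re (h (?w ?y) ?z)
      - s * (1 - s) * Re (h (?w ?z) ?y) + s^2 * Re (h (?w ?z) ?z)"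
    unfolding op_moment_def wx
    by (subst xe) (simp add: form_simps algebra_simps power2_eq_square)
  then show ?thesis
    using op_moment_T[OF u, of k l] op_moment_compl_op[OF u, of k l]
    unfolding cross cross' by (simp add: op_moment_def)
qed

text \<open>The moments of a preimage \<open>u\<close> of \<open>x\<close> under T - s form the
  array \<open>V\<close> that \<open>moment_array_lower_bound\<close> asks for.\<close>

lemma lower_bound_of_surjective_shifts:
  assumes b: "0 < b" "b \<le> 1"
    and surj: "\<And>s x. 0 \<le> s \<Longrightarrow> s < b \<Longrightarrow> x \<in> D \<Longrightarrow> \<exists>u\<in>D. x = T u - scale (complex_of_real s) u"
    and x: "x \<in> D"
  shows "b * sqn x \<le> Re (h (T x) x)"
proof -
  have "b * op_moment x 0 0 \<le> op_moment x 1 0"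
  proof (rule moment_array_lower_bound[OF moment_array_op_moment[OF x] b])
    fix s assume s: "0 \<le> s" "s < b"
    obtain u where u: "u \<in> D" "x = T u - scale (complex_of_real s) u"
      using surj[OF s x] by blast
    then show "\<exists>V. moment_array V \<and> (\<forall>k l. op_moment x k l = (1 - s)^2 * V (Suc (Suc k)) l
        - 2 * (s * (1 - s)) * V (Suc k) (Suc l) + s^2 * V k (Suc (Suc l)))"
      using moment_array_op_moment op_moment_shifted by blast
  qed
  then show ?thesis by (simp add: op_moment_def sqn_def)
qed

end

section \<open>Norm bounds from surjective shifts\<close>

text \<open>The operator \<open>T = (1 + G)\<^sup>-\<^sup>1\<close> satisfies \<open>0 \<le> T \<le> 1\<close>, and \<open>T - s\<close> is onto for \<open>0 \<le> s < 1/2\<close>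
  because \<open>G - (1 - s)/s\<close> is.\<close>

lemma contraction_of_surjective_shifts:
  assumes D: "subspace D" and G: "linear_on D G"
    and G_sym: "\<And>x y. x \<in> D \<Longrightarrow> y \<in> D \<Longrightarrow> h (G x) y = h x (G y)"
    and G_nonneg: "\<And>x. x \<in> D \<Longrightarrow> 0 \<le> Re (h (G x) x)"
    and bij: "bij_betw (\<lambda>x. x + G x) D D"
    and surj: "\<And>r x. 1 < r \<Longrightarrow> x \<in> D \<Longrightarrow> \<exists>u\<in>D. x = G u - scale (complex_of_real r) u"
    and x: "x \<in> D"
  shows "sqn (G x) \<le> sqn x"
proof -
  define M where "M x = x + G x" for x
  define T where "T = inv_into D M"
  have bij: "bij_betw M D D" using bij by (simp add: M_def[abs_def])
  have M: "linear_on D M"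
    using G D unfolding linear_on_def M_def by (auto simp: algebra_simps subspace_add image_subset_iff)
  have TD: "T y \<in> D" if "y \<in> D" for y
    using bij that unfolding T_def by (metis bij_betw_def inv_into_into)
  have MT: "M (T y) = y" if "y \<in> D" for y
    using bij that unfolding T_def by (metis bij_betw_inv_into_right)
  have TM: "T (M y) = y" if "y \<in> D" for y
    using bij that unfolding T_def by (metis bij_betw_inv_into_left)
  have T: "linear_on D T"
    unfolding linear_on_def
  proof (intro conjI ballI allI)
    show "T ` D \<subseteq> D" using TD by auto
    fix y z assume yz: "y \<in> D" "z \<in> D"
    then have "M (T y + T z) = y + z" using M TD MT unfolding linear_on_def by metis
    then show "T (y + z) = T y + T z" using TM subspace_add[OF D] TD yz by metis
  next
    fix c y assume y: "y \<in> D"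
    then have "M (scale c (T y)) = scale c y" using M TD MT unfolding linear_on_def by metis
    then show "T (scale c y) = scale c (T y)" using TM subspace_scale[OF D] TD y by metis
  qed
  have GD: "G y \<in> D" if "y \<in> D" for y using linear_on_mem[OF G that] .
  have M_sym: "h (M y) z = h y (M z)" if "y \<in> D" "z \<in> D" for y z
    using that G_sym by (simp add: M_def form_simps)
  \<comment> \<open>Since \<open>T (M x) = x\<close>, expanding both sides of this lower bound
    leaves exactly the contraction estimate.\<close>
  have "1/2 * sqn (M x) \<le> Re (h (T (M x)) (M x))"
  proof (rule lower_bound_of_surjective_shifts[OF D T])
    fix y z assume yz: "y \<in> D" "z \<in> D"
    then show "h (T y) z = h y (T z)" using M_sym[of "T y" "T z"] TD MT by simp
  next
    fix y assume y: "y \<in> D"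
    have GTy: "Re (h (T y) (G (T y))) = Re (h (G (T y)) (T y))"
      using G_sym[OF TD TD] y by simp
    have ye: "y = T y + G (T y)" using MT[OF y] by (simp add: M_def)
    have "Re (h (T y) y) = sqn (T y) + Re (h (G (T y)) (T y))"
      by (subst (2) ye) (simp add: form_simps sqn_def GTy)
    then show "0 \<le> Re (h (T y) y)" using sqn_nonneg[of "T y"] G_nonneg[OF TD[OF y]] by simp
    have "Re (h (G (T y)) y) = Re (h (G (T y)) (T y)) + sqn (G (T y))"
      by (subst (2) ye) (simp add: form_simps sqn_def)
    moreover have "sqn y = Re (h (T y) y) + Re (h (G (T y)) y)"
      unfolding sqn_def by (subst (1) ye) (simp add: form_simps)
    ultimately show "Re (h (T y) y) \<le> sqn y"
      using sqn_nonneg[of "G (T y)"] G_nonneg[OF TD[OF y]] by simp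
  next
    fix s :: real and y assume s: "0 \<le> s" "s < 1/2" and y: "y \<in> D"
    show "\<exists>u\<in>D. y = T u - scale (complex_of_real s) u"
    proof (cases "s = 0")
      case True
      then show ?thesis using y TM linear_on_mem[OF M] by (intro bexI[of _ "M y"]) auto
    next
      case False
      \<comment> \<open>On \<open>M v\<close> the operator T - s acts as -s (G - r), and s < 1/2
        means r > 1; hence the solution \<open>M v\<close>.\<close>
      define r where "r = (1 - s) / s"
      have "1 < r" using s False by (simp add: r_def field_simps)
      then obtain v where v: "v \<in> D"
        "scale (complex_of_real (- 1 / s)) y = G v - scale (complex_of_real r) v"
        using surj[of r "scale (complex_of_real (- 1 / s)) y"] y subspace_scale[OF D] by blast
      have "y = scale (complex_of_real (- s)) (scale (complex_of_real (- 1 / s)) y)"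
        using False by simp
      also have "\<dots> = v - scale (complex_of_real s) (M v)"
        using False unfolding v(2) M_def r_def
        by (simp add: scale_right_diff_distrib scale_right_distrib scale_left_diff_distrib)
      finally show ?thesis
        using v(1) TM linear_on_mem[OF M] by (intro bexI[of _ "M v"]) auto
    qed
  qed (use x linear_on_mem[OF M] in auto)
  then have "sqn (M x) \<le> 2 * Re (h x (M x))" using TM[OF x] by simp
  then show ?thesis
    unfolding M_def by (simp add: sqn_add form_add_right) (simp add: sqn_def)
qed

text \<open>The form of BC on the diagonal is \<open>sqn (C y)\<close>, so BC/c is symmetric and
  positive, hence a contraction. Cauchy-Schwarz then bounds \<open>C\<close>, and duality bounds
  \<open>B\<close>.\<close>

lemma bounded_of_adjoint_pair:
  assumes D: "subspace D" and B: "linear_on D B" and C: "linear_on D C"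
    and adjoint: "\<And>x y. x \<in> D \<Longrightarrow> y \<in> D \<Longrightarrow> h (B x) y = h x (C y)"
    and c: "0 < c"
    and bij: "\<And>z. c \<le> cmod z \<Longrightarrow> bij_betw (\<lambda>x. B (C x) - scale z x) D D"
    and x: "x \<in> D"
  shows "sqn (B x) \<le> c * sqn x" "sqn (C x) \<le> c * sqn x"
proof -
  have memB: "B y \<in> D" and memC: "C y \<in> D" if "y \<in> D" for y
    using that linear_on_mem[OF B] linear_on_mem[OF C] by auto
  have adjoint': "h (C x) y = h x (B y)" if "x \<in> D" "y \<in> D" for x y
    using adjoint[OF that(2,1)] form_cnj[of "C x" y] form_cnj[of "x" "B y"] by simp
  define e where "e = complex_of_real (1 / c)"
  define G where "G x = scale e (B (C x))" for x
  have BC: "linear_on D (\<lambda>x. B (C x))" by (rule linear_on_compose[OF B C])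
  have G: "linear_on D G"
    using BC D unfolding linear_on_def G_def
    by (auto simp: scale_right_distrib subspace_scale image_subset_iff mult.commute)
  have e: "e * complex_of_real c = 1" "complex_of_real c * e = 1" using c by (auto simp: e_def)
  have "sqn (G y) \<le> sqn y" if y: "y \<in> D" for y
  proof (rule contraction_of_surjective_shifts[OF D G _ _ _ _ y])
    fix y z assume "y \<in> D" "z \<in> D"
    then show "h (G y) z = h y (G z)"
      by (simp add: G_def form_simps adjoint adjoint' memB memC e_def)
  next
    fix y assume "y \<in> D"
    then have "h (G y) y = complex_of_real (1 / c * sqn (C y))"
      by (simp add: G_def form_simps adjoint memC e_def form_self)
    then show "0 \<le> Re (h (G y) y)" using c sqn_nonneg[of "C y"] by simp
  next
    have s: "bij_betw (scale e) D D"
    proof (rule bij_betw_byWitness[where f' = "scale (complex_of_real c)"])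
      show "\<forall>a\<in>D. scale (complex_of_real c) (scale e a) = a" "\<forall>a\<in>D. scale e (scale (complex_of_real c) a) = a"
        using e by (simp_all only: scale_scale scale_one ball_simps) simp_all
    qed (use D in \<open>auto simp: subspace_scale\<close>)
    \<comment> \<open>The parameter z = -c gives c (1 + G); z = r c, used below, gives c (G -
      r).\<close>
    have "bij_betw (\<lambda>x. B (C x) - scale (complex_of_real (- c)) x) D D"
      using c by (intro bij) simp
    from bij_betw_trans[OF this s] show "bij_betw (\<lambda>x. x + G x) D D"
      by (rule bij_betw_cong[THEN iffD1, rotated])
         (simp add: G_def scale_right_distrib e algebra_simps)
  next
    fix r :: real and y assume r: "1 < r" and y: "y \<in> D"
    have "bij_betw (\<lambda>x. B (C x) - scale (complex_of_real (r * c)) x) D D"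
      using c r by (intro bij) (simp only: norm_of_real abs_mult, simp)
    then obtain u where u: "u \<in> D" "scale (complex_of_real c) y = B (C u) - scale (complex_of_real (r * c)) u"
      using y subspace_scale[OF D y] unfolding bij_betw_def by (metis (no_types, lifting) imageE)
    have "y = scale e (scale (complex_of_real c) y)" by (simp add: e)
    also have "\<dots> = G u - scale (complex_of_real r) u"
      unfolding u(2) G_def by (simp add: scale_right_diff_distrib mult.left_commute[of e] e)
    finally show "\<exists>u\<in>D. y = G u - scale (complex_of_real r) u" using u(1) by blast
  qed
  then have BC_le: "sqn (B (C y)) \<le> c^2 * sqn y" if "y \<in> D" for y
    using that c by (simp add: G_def sqn_scale e_def norm_divide power_divide field_simps)
  have C_le: "sqn (C y) \<le> c * sqn y" if y: "y \<in> D" for y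
  proof -
    have "sqn (C y) = Re (h (B (C y)) y)" using adjoint[OF memC[OF y] y] by (simp add: sqn_def)
    also have "\<dots> \<le> cmod (h (B (C y)) y)" by (rule complex_Re_le_cmod)
    also have "\<dots> \<le> sqrt (sqn (B (C y))) * sqrt (sqn y)" by (rule cmod_form_le)
    also have "\<dots> \<le> sqrt (c^2 * sqn y) * sqrt (sqn y)"
      using BC_le[OF y] by (intro mult_right_mono) (auto simp: sqn_nonneg)
    also have "\<dots> = c * sqn y" using c by (simp add: real_sqrt_mult sqn_nonneg)
    finally show ?thesis .
  qed
  show "sqn (C x) \<le> c * sqn x" using C_le[OF x] .
  have "sqn (B x) = Re (h x (C (B x)))" using adjoint[OF x memB[OF x]] by (simp add: sqn_def)
  also have "\<dots> \<le> cmod (h x (C (B x)))" by (rule complex_Re_le_cmod)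
  finally have "(sqn (B x))^2 \<le> (cmod (h x (C (B x))))^2" by (rule power_mono) (rule sqn_nonneg)
  also have "\<dots> \<le> sqn x * sqn (C (B x))" by (rule Cauchy_Schwarz)
  also have "\<dots> \<le> sqn x * (c * sqn (B x))" using C_le[OF memB[OF x]] by (intro mult_left_mono sqn_nonneg)
  finally have "sqn (B x) * sqn (B x) \<le> (c * sqn x) * sqn (B x)" by (simp add: power2_eq_square mult.left_commute)
  then show "sqn (B x) \<le> c * sqn x"
    using sqn_nonneg[of "B x"] sqn_nonneg[of x] c
    by (cases "sqn (B x) = 0") (auto simp: mult_le_cancel_right)
qed

text \<open>By duality, boundedness of \<open>B\<close> on the dense set \<open>D\<close> makes \<open>C\<close> bounded everywhere.\<close>

lemma adjoint_pair_extends: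
  assumes c: "0 \<le> c" and D_dense: "\<And>y. \<exists>u. (\<forall>n. u n \<in> D) \<and> (\<lambda>n. sqn (u n - y)) \<longlonglongrightarrow> 0"
    and B_D: "\<And>x. x \<in> D \<Longrightarrow> sqn (B x) \<le> c * sqn x"
    and C_diff: "\<And>x y. C (x - y) = C x - C y"
    and BC: "\<And>x y. x \<in> D \<Longrightarrow> h (B x) y = h x (C y)"
    and CB: "\<And>x y. x \<in> D \<Longrightarrow> h (C x) y = h x (B y)"
  shows "h (B y) z = h y (C z)"
proof -
  have C_le: "sqn (C y) \<le> c * sqn y" for y
  proof -
    \<comment> \<open>Approximating \<open>C y\<close> itself from \<open>D\<close> lets the bound
      of \<open>B\<close> on \<open>D\<close> control \<open>sqn (C y)\<close> by duality.\<close>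
    obtain u where u: "\<And>n. u n \<in> D" "(\<lambda>n. sqn (u n - C y)) \<longlonglongrightarrow> 0"
      using D_dense by blast
    have "(cmod (h (u n) (C y)))^2 \<le> sqn (u n) * (c * sqn y)" for n
    proof -
      have "(cmod (h (u n) (C y)))^2 = (cmod (h (B (u n)) y))^2" using BC[OF u(1)] by simp
      also have "\<dots> \<le> sqn (B (u n)) * sqn y" by (rule Cauchy_Schwarz)
      also have "\<dots> \<le> c * sqn (u n) * sqn y" by (intro mult_right_mono B_D u sqn_nonneg)
      finally show ?thesis by (simp add: mult_ac)
    qed
    moreover have "(\<lambda>n. (cmod (h (u n) (C y)))^2) \<longlonglongrightarrow> (cmod (h (C y) (C y)))^2"
      by (intro tendsto_intros form_tendsto u)
    moreover have "(\<lambda>n. sqn (u n) * (c * sqn y)) \<longlonglongrightarrow> sqn (C y) * (c * sqn y)"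
      by (intro tendsto_mult_right sqn_tendsto u)
    ultimately have "(cmod (h (C y) (C y)))^2 \<le> sqn (C y) * (c * sqn y)"
      using LIMSEQ_le by blast
    then have "sqn (C y) * sqn (C y) \<le> sqn (C y) * (c * sqn y)"
      by (simp add: form_self power2_eq_square)
    moreover have "0 \<le> c * sqn y" using c sqn_nonneg by simp
    ultimately show ?thesis
      using sqn_nonneg[of "C y"] by (cases "sqn (C y) = 0") (auto simp: mult_le_cancel_left)
  qed
  have sym: "h (B y) x = h y (C x)" if "x \<in> D" for x
    using CB[OF that, of y] form_cnj[of "B y" x] form_cnj[of y "C x"] by simp
  obtain u where u: "\<And>n. u n \<in> D" "(\<lambda>n. sqn (u n - z)) \<longlonglongrightarrow> 0"
    using D_dense by blast
  have "(\<lambda>n. sqn (C (u n) - C z)) \<longlonglongrightarrow> 0"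
  proof (rule Lim_null_comparison[where g = "\<lambda>n. c * sqn (u n - z)"])
    show "\<forall>\<^sub>F n in sequentially. norm (sqn (C (u n) - C z)) \<le> c * sqn (u n - z)"
      using C_le by (simp add: C_diff[symmetric] sqn_nonneg)
    show "(\<lambda>n. c * sqn (u n - z)) \<longlonglongrightarrow> 0" using tendsto_mult_left[OF u(2), of c] by simp
  qed
  from form_tendsto(2)[OF this, of y] have "(\<lambda>n. h (B y) (u n)) \<longlonglongrightarrow> h y (C z)"
    using sym[OF u(1)] by simp
  then show ?thesis using form_tendsto(2)[OF u(2)] LIMSEQ_unique by blast
qed

end

section \<open>Anti-dual pairs\<close>

context anti_dual_pair
begin

lemma ip_zero_left: "ip 0 x = 0"
  using scale_left[of 0 0 x] by simp

lemma ip_minus_left: "ip (- f) x = - ip f x"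
  using scale_left[of "-1" f x] by simp

lemma ip_diff_left: "ip (f - g) x = ip f x - ip g x"
  using add_left[of f "- g" x] by (simp add: ip_minus_left)

lemma ip_zero_right: "ip f 0 = 0"
  using scale_right[of f 0 0] by simp

lemma ip_diff_right: "ip f (x - y) = ip f x - ip f y"
  using add_right[of f x "sE (-1) y"] scale_right[of f "-1" y] by simp

lemma ip_eqI: "(\<And>x. ip f x = ip g x) \<Longrightarrow> f = g"
  using separates_left[of "f - g"] by (simp add: ip_diff_left)

section \<open>Weak topologies and their continuous functionals\<close>

lemma openin_sigma_F_eval: "open U \<Longrightarrow> openin (sigma_F ip) {f. ip f x \<in> U}"
  unfolding sigma_F_def by (rule topology_generated_by_Basis) blast

lemma openin_sigma_E_eval: "open U \<Longrightarrow> openin (sigma_E ip) {x. ip f x \<in> U}"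
  unfolding sigma_E_def by (rule topology_generated_by_Basis) blast

lemma topspace_sigma_E: "topspace (sigma_E ip) = UNIV"
  using openin_subset[OF openin_sigma_E_eval[of UNIV]] by auto

text \<open>A weak neighbourhood constrains finitely many functionals only, so it contains a
  translate of their common kernel.\<close>

lemma openin_sigma_E_nhd:
  assumes "openin (sigma_E ip) U" "x \<in> U"
  shows "\<exists>S. finite S \<and> (\<forall>y. (\<forall>f\<in>S. ip f y = ip f x) \<longrightarrow> y \<in> U)"
proof -
  have "generate_topology_on {{x. ip f x \<in> U} | f U. open U} U"
    using assms(1) by (simp add: sigma_E_def openin_topology_generated_by_iff)
  then show ?thesis using assms(2)
  proof (induction U)
    case Empty
    then show ?case by simp
  next
    case (Int a b)
    then obtain S T where "finite S" "\<forall>y. (\<forall>f\<in>S. ip f y = ip f x) \<longrightarrow> y \<in> a"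
      "finite T" "\<forall>y. (\<forall>f\<in>T. ip f y = ip f x) \<longrightarrow> y \<in> b" by auto
    then show ?case by (intro exI[of _ "S \<union> T"]) auto
  next
    case (UN K)
    then obtain k where k: "k \<in> K" "x \<in> k" by blast
    from UN.IH[OF this] k show ?case by blast
  next
    case (Basis s)
    then obtain f V where s: "s = {x. ip f x \<in> V}" by blast
    then show ?case using Basis(2) by (intro exI[of _ "{f}"]) auto
  qed
qed

text \<open>Induction on \<open>S\<close>: if \<open>f\<close> does not vanish on the kernel of the
  others, a vector \<open>w\<close> there with \<open>ip f w\<close> nonzero determines the multiple
  of \<open>f\<close> to subtract.\<close>

lemma functional_vanishing_on_finite_kernel:
  assumes "finite S"
    and "\<And>x y. \<phi> (x + y) = \<phi> x + \<phi> y" and "\<And>c x. \<phi> (sE c x) = cnj c * \<phi> x"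
    and "\<And>x. (\<forall>f\<in>S. ip f x = 0) \<Longrightarrow> \<phi> x = 0"
  shows "\<exists>g. \<forall>x. \<phi> x = ip g x"
  using assms
proof (induction S arbitrary: \<phi> rule: finite_induct)
  case empty
  then show ?case by (intro exI[of _ 0]) (simp add: ip_zero_left)
next
  case (insert f S)
  show ?case
  proof (cases "\<forall>x. (\<forall>g\<in>S. ip g x = 0) \<longrightarrow> ip f x = 0")
    case True
    then show ?thesis using insert.prems by (intro insert.IH) auto
  next
    case False
    then obtain w where w: "\<forall>g\<in>S. ip g w = 0" "ip f w \<noteq> 0" by blast
    define c where "c = \<phi> w / ip f w"
    have "\<exists>g. \<forall>x. \<phi> x - c * ip f x = ip g x"
    proof (rule insert.IH)
      fix x assume x: "\<forall>g\<in>S. ip g x = 0"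
      define t where "t = cnj (ip f x / ip f w)"
      have "\<forall>g\<in>insert f S. ip g (x - sE t w) = 0"
        using x w by (simp add: ip_diff_right scale_right t_def)
      then have "\<phi> (x - sE t w) = 0" by (rule insert.prems(3))
      then show "\<phi> x - c * ip f x = 0"
        using insert.prems(1)[of "x - sE t w" "sE t w"] by (simp add: insert.prems(2) t_def c_def)
    qed (simp_all add: insert.prems add_right scale_right algebra_simps)
    then obtain g where g: "\<And>x. \<phi> x - c * ip f x = ip g x" by blast
    have "\<phi> x = ip (g + sF c f) x" for x
      using g[of x] by (simp add: add_left scale_left diff_eq_eq)
    then show ?thesis by blast
  qed
qed

text \<open>Near 0 the functional is bounded on a common kernel of finitely many elements of
  \<open>F\<close>; being bounded on a subspace, it vanishes there by rescaling.\<close>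

lemma continuous_functional_representable:
  assumes cont: "continuous_map (sigma_E ip) euclidean \<phi>"
    and add: "\<And>x y. \<phi> (x + y) = \<phi> x + \<phi> y" and scale: "\<And>c x. \<phi> (sE c x) = cnj c * \<phi> x"
  shows "\<exists>g. \<forall>x. \<phi> x = ip g x"
proof -
  have "openin (sigma_E ip) {x \<in> topspace (sigma_E ip). \<phi> x \<in> ball 0 1}"
    by (rule openin_continuous_map_preimage[OF cont]) simp
  then have op: "openin (sigma_E ip) {x. \<phi> x \<in> ball 0 1}" by (simp add: topspace_sigma_E)
  have "\<phi> 0 = 0" using scale[of 0 0] by simp
  then have "0 \<in> {x. \<phi> x \<in> ball 0 1}" by simp
  from openin_sigma_E_nhd[OF op this] obtain S where
    S: "finite S" "\<And>y. (\<forall>f\<in>S. ip f y = 0) \<Longrightarrow> cmod (\<phi> y) < 1"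
    by (auto simp: ip_zero_right)
  show ?thesis
  proof (rule functional_vanishing_on_finite_kernel[OF S(1) add scale])
    fix x assume x: "\<forall>f\<in>S. ip f x = 0"
    show "\<phi> x = 0"
    proof (rule ccontr)
      assume "\<phi> x \<noteq> 0"
      moreover have "cmod (\<phi> (sE (cnj (1 / \<phi> x)) x)) < 1"
        using x by (intro S(2)) (simp add: scale_right)
      ultimately show False by (simp add: scale)
    qed
  qed
qed

lemma weak_ops_EE_add: "B \<in> weak_ops_EE sE ip \<Longrightarrow> B (x + y) = B x + B y"
  and weak_ops_EE_scale: "B \<in> weak_ops_EE sE ip \<Longrightarrow> B (sE c x) = sE c (B x)"
  by (auto simp: weak_ops_EE_def Vector_Spaces.linear_iff)

lemma weak_ops_EF_add: "T \<in> weak_ops_EF sE sF ip \<Longrightarrow> T (x + y) = T x + T y"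
  and weak_ops_EF_scale: "T \<in> weak_ops_EF sE sF ip \<Longrightarrow> T (sE c x) = sF c (T x)"
  by (auto simp: weak_ops_EF_def Vector_Spaces.linear_iff)

lemma weak_ops_EE_diff:
  assumes "B \<in> weak_ops_EE sE ip"
  shows "B (x - y) = B x - B y"
  using weak_ops_EE_add[OF assms, of x "sE (-1) y"] weak_ops_EE_scale[OF assms, of "-1" y] by simp

lemma adj_eqI:
  assumes "\<And>x. ip g x = ip f (B x)"
  shows "adj ip B f = g"
  unfolding adj_def by (rule the_equality) (use assms in \<open>auto intro: ip_eqI\<close>)

text \<open>Weak continuity of \<open>ip f \<circ> B\<close> supplies the element described in
  \<open>adj\<close>.\<close>

lemma ip_adj:
  assumes B: "B \<in> weak_ops_EE sE ip"
  shows "ip (adj ip B f) x = ip f (B x)"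
proof -
  have "continuous_map (sigma_E ip) euclidean (ip f)"
    by (simp add: continuous_map_def topspace_sigma_E openin_sigma_E_eval)
  then have "continuous_map (sigma_E ip) euclidean (ip f \<circ> B)"
    using B by (intro continuous_map_compose) (auto simp: weak_ops_EE_def)
  then have "\<exists>g. \<forall>x. (ip f \<circ> B) x = ip g x"
    by (rule continuous_functional_representable)
       (simp_all add: weak_ops_EE_add[OF B] weak_ops_EE_scale[OF B] add_right scale_right)
  then obtain g where g: "\<And>x. ip f (B x) = ip g x" by auto
  then show ?thesis using adj_eqI[of g f B] by simp
qed

text \<open>The scalar Cauchy property handles subbasic neighbourhoods of 0 and persists under
  finite intersections and unions, so completeness applies.\<close>

lemma weak_star_limit_exists:
  assumes complete: "weak_star_seq_complete ip" and Cau: "\<And>x. Cauchy (\<lambda>n. ip (s n) x)"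
  shows "\<exists>f. \<forall>x. (\<lambda>n. ip (s n) x) \<longlonglongrightarrow> ip f x"
proof -
  have "\<exists>N. \<forall>m\<ge>N. \<forall>n\<ge>N. s m - s n \<in> U" if U: "openin (sigma_F ip) U" "0 \<in> U" for U
  proof -
    have "generate_topology_on {{f. ip f x \<in> U} | x U. open U} U"
      using U(1) by (simp add: sigma_F_def openin_topology_generated_by_iff)
    then show ?thesis using U(2)
    proof (induction U)
      case Empty
      then show ?case by simp
    next
      case (Int a b)
      then obtain M N where "\<forall>m\<ge>M. \<forall>n\<ge>M. s m - s n \<in> a" "\<forall>m\<ge>N. \<forall>n\<ge>N. s m - s n \<in> b" by auto
      then show ?case by (intro exI[of _ "max M N"]) auto
    next
      case (UN K)
      then obtain k where k: "k \<in> K" "0 \<in> k" by blast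
      from UN.IH[OF this] k show ?case by blast
    next
      case (Basis t)
      then obtain x V where t: "t = {f. ip f x \<in> V}" and V: "open V" by blast
      then have "0 \<in> V" using Basis(2) by (simp add: ip_zero_left)
      then obtain e where e: "e > 0" "ball 0 e \<subseteq> V" using V by (meson openE)
      obtain N where N: "\<And>m n. m \<ge> N \<Longrightarrow> n \<ge> N \<Longrightarrow> norm (ip (s m) x - ip (s n) x) < e"
        using CauchyD[OF Cau[of x] e(1)] by blast
      have "ip (s m - s n) x \<in> V" if "m \<ge> N" "n \<ge> N" for m n
        using N[OF that] e(2) by (auto simp: ip_diff_left)
      then show ?case unfolding t by blast
    qed
  qed
  then have "weak_star_Cauchy ip s" unfolding weak_star_Cauchy_def by blast
  then obtain f where f: "limitin (sigma_F ip) s f sequentially"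
    using complete unfolding weak_star_seq_complete_def by blast
  have "(\<lambda>n. ip (s n) x) \<longlonglongrightarrow> ip f x" for x
  proof (rule topological_tendstoI)
    fix V assume "open V" "ip f x \<in> V"
    then have "eventually (\<lambda>n. s n \<in> {f. ip f x \<in> V}) sequentially"
      using f openin_sigma_F_eval[of V x] unfolding limitin_def by blast
    then show "eventually (\<lambda>n. ip (s n) x \<in> V) sequentially" by simp
  qed
  then show ?thesis by blast
qed

section \<open>Positive operators and their order\<close>

lemma positive_formI:
  assumes "\<And>x y. T (x + y) = T x + T y" "\<And>c x. T (sE c x) = sF c (T x)"
    "\<And>x. ip (T x) x \<in> \<real>\<^sub>\<ge>\<^sub>0"
  shows "positive_form sE (\<lambda>x y. ip (T x) y)"
  by unfold_locales (simp_all add: assms add_left scale_left add_right scale_right)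

lemma positive_extension_form:
  assumes "T \<in> positive_extensions sE sF ip D A"
  shows "positive_form sE (\<lambda>x y. ip (T x) y)"
  using assms by (intro positive_formI)
    (auto simp: positive_extensions_def positive_operator_on_def weak_ops_EF_add weak_ops_EF_scale)

text \<open>A positive operator is symmetric, so \<open>x \<mapsto> \<langle>T x, y\<rangle>\<close> is the conjugate of \<open>x \<mapsto> \<langle>T y, x\<rangle>\<close>.\<close>

lemma positive_weakly_continuous:
  assumes "\<And>x y. T (x + y) = T x + T y" "\<And>c x. T (sE c x) = sF c (T x)"
    "\<And>x. ip (T x) x \<in> \<real>\<^sub>\<ge>\<^sub>0"
  shows "T \<in> weak_ops_EF sE sF ip"
proof -
  interpret T: positive_form sE "\<lambda>x y. ip (T x) y" by (rule positive_formI[OF assms])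
  have "continuous_map (sigma_E ip) (sigma_F ip) T"
    unfolding sigma_F_def
  proof (rule continuous_on_generated_topo)
    fix U assume "U \<in> {{f. ip f x \<in> U} | x U. open U}"
    then obtain y V where U: "U = {f. ip f y \<in> V}" and V: "open V" by blast
    have "T -` U = {x. ip (T y) x \<in> cnj -` V}"
      unfolding U using T.form_cnj[of y] by auto
    moreover have "open (cnj -` V)" by (intro open_vimage V continuous_intros)
    ultimately show "openin (sigma_E ip) (T -` U \<inter> topspace (sigma_E ip))"
      using openin_sigma_E_eval[of "cnj -` V" "T y"] by (simp add: topspace_sigma_E)
  next
    show "T ` topspace (sigma_E ip) \<subseteq> \<Union> {{f. ip f x \<in> U} | x U. open U}" by blast
  qed
  then show ?thesis
    using assms by (simp add: weak_ops_EF_def Vector_Spaces.linear_iff E.vector_space_axioms F.vector_space_axioms)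
qed

text \<open>The difference is a positive form with zero diagonal, so Cauchy-Schwarz annihilates
  it.\<close>

lemma operator_le_antisym:
  assumes S: "S \<in> weak_ops_EF sE sF ip" and T: "T \<in> weak_ops_EF sE sF ip"
    and le: "operator_le ip S T" "operator_le ip T S"
  shows "S = T"
proof
  fix x
  interpret d: positive_form sE "\<lambda>x y. ip (T x - S x) y"
    using S T le(1) by (intro positive_formI)
      (auto simp: weak_ops_EF_add weak_ops_EF_scale operator_le_def F.scale_right_diff_distrib)
  have "0 \<le> Re (ip (S x - T x) x)"
    using le(2) by (simp add: operator_le_def complex_nonneg_Reals_iff)
  then have "d.sqn x \<le> 0" unfolding d.sqn_def by (simp add: ip_diff_left)
  then have "d.sqn x = 0" using d.sqn_nonneg[of x] by simp
  then have "ip (T x - S x) y = 0" for y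
    using d.Cauchy_Schwarz[of x y] by simp
  then show "S x = T x" using separates_left[of "T x - S x"] by simp
qed

section \<open>Density and the smallest positive extension\<close>

text \<open>Among the positive extensions, the smallest one is characterised by density of \<open>D\<close> for its own
  seminorm.\<close>

definition dense_for :: "('e \<Rightarrow> 'f) \<Rightarrow> 'e set \<Rightarrow> bool" where
  "dense_for T D \<longleftrightarrow>
     (\<forall>y. \<exists>u. (\<forall>n. u n \<in> D) \<and> (\<lambda>n. Re (ip (T (u n - y)) (u n - y))) \<longlonglongrightarrow> 0)"

text \<open>Compress any positive extension \<open>P\<close> to the completion of \<open>D\<close>:
  \<open>N y\<close> is the weak limit of \<open>P\<close> along a projection sequence of
  \<open>y\<close>.\<close>

lemma dense_positive_extension_exists:
  assumes complete: "weak_star_seq_complete ip" and D: "E.subspace D"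
    and P: "P \<in> positive_extensions sE sF ip D A"
  shows "\<exists>N\<in>positive_extensions sE sF ip D A. dense_for N D"
proof -
  interpret P: positive_form sE "\<lambda>x y. ip (P x) y" by (rule positive_extension_form[OF P])
  have "\<exists>f u. P.projection_seq D y u \<and> (\<forall>x. (\<lambda>n. ip (P (u n)) x) \<longlonglongrightarrow> ip f x)" for y
  proof -
    obtain u where u: "P.projection_seq D y u" using P.projection_seq_exists[OF D] by blast
    have "Cauchy (\<lambda>n. ip (P (u n)) x)" for x
    proof (rule CauchyI)
      fix e :: real assume e: "0 < e"
      define q where "q = P.sqn x + 1"
      have q: "0 < q" using P.sqn_nonneg[of x] by (simp add: q_def)
      then have "0 < e^2 / q" using e by simp
      then obtain N where N: "\<And>m n. m \<ge> N \<Longrightarrow> n \<ge> N \<Longrightarrow> P.sqn (u m - u n) < e^2 / q"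
        using u unfolding P.projection_seq_def by meson
      have "norm (ip (P (u m)) x - ip (P (u n)) x) < e" if mn: "m \<ge> N" "n \<ge> N" for m n
      proof -
        have "(cmod (ip (P (u m - u n)) x))^2 \<le> P.sqn (u m - u n) * P.sqn x" by (rule P.Cauchy_Schwarz)
        also have "\<dots> \<le> P.sqn (u m - u n) * q" by (intro mult_left_mono P.sqn_nonneg) (simp add: q_def)
        also have "\<dots> < e^2" using N[OF mn] q by (simp add: pos_less_divide_eq)
        finally show ?thesis using e by (simp add: P.form_diff_left power_less_imp_less_base)
      qed
      then show "\<exists>M. \<forall>m\<ge>M. \<forall>n\<ge>M. norm (ip (P (u m)) x - ip (P (u n)) x) < e" by blast
    qed
    from weak_star_limit_exists[OF complete this] u show ?thesis by blast
  qed
  then obtain N u where u: "\<And>y. P.projection_seq D y (u y)"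
    and N: "\<And>y x. (\<lambda>n. ip (P (u y n)) x) \<longlonglongrightarrow> ip (N y) x" by metis
  \<comment> \<open>The limit is the same for all projection sequences, so linearity and agreement
    with \<open>P\<close> on \<open>D\<close> follow from convenient ones.\<close>
  have N_eq: "N y = f" if v: "P.projection_seq D y v" and f: "\<And>x. (\<lambda>n. ip (P (v n)) x) \<longlonglongrightarrow> ip f x" for y v f
  proof (rule ip_eqI)
    fix x
    have "(\<lambda>n. ip (P (u y n)) x - ip (P (v n)) x) \<longlonglongrightarrow> ip (N y) x - ip f x"
      by (intro tendsto_diff N f)
    with P.projection_seq_unique[OF D u v, where z = x] have "ip (N y) x - ip f x = 0"
      by (rule LIMSEQ_unique[THEN sym])
    then show "ip (N y) x = ip f x" by simp
  qed
  have N_add: "N (y + z) = N y + N z" for y z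
    using P.projection_seq_add[OF D u u, of y z]
    by (rule N_eq) (simp add: P.form_add_left add_left tendsto_add N)
  have N_scale: "N (sE c y) = sF c (N y)" for c y
    using P.projection_seq_scale[OF D u, of c y]
    by (rule N_eq) (simp add: P.form_scale_left scale_left tendsto_mult_left N)
  have N_D: "N y = P y" if "y \<in> D" for y
    using P.projection_seq_const[OF that] by (rule N_eq) simp
  \<comment> \<open>The residual is asymptotically orthogonal to \<open>u y n\<close>; this yields
    positivity of \<open>N\<close> and, later, density.\<close>
  have sqn_lim: "(\<lambda>n. complex_of_real (P.sqn (u y n))) \<longlonglongrightarrow> ip (N y) y" for y
  proof -
    have "(\<lambda>n. cnj (ip (P (u y n - y)) (u y n))) \<longlonglongrightarrow> cnj 0"
      by (rule tendsto_cnj[OF P.projection_seq_form_self[OF u]])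
    then have "(\<lambda>n. ip (P (u y n)) (u y n - y)) \<longlonglongrightarrow> 0"
      by (simp only: P.form_cnj[symmetric] complex_cnj_zero)
    from tendsto_add[OF this N[of y y]]
    have "(\<lambda>n. ip (P (u y n)) (u y n)) \<longlonglongrightarrow> ip (N y) y" by (simp add: ip_diff_right)
    then show ?thesis by (simp add: P.form_self)
  qed
  have N_pos: "ip (N y) y \<in> \<real>\<^sub>\<ge>\<^sub>0" for y
    by (rule closed_sequentially[OF closed_nonneg_Reals_complex _ sqn_lim[of y]])
       (simp add: P.sqn_nonneg)
  have "N \<in> positive_extensions sE sF ip D A"
    using positive_weakly_continuous[OF N_add N_scale N_pos] N_pos N_D P
    by (simp add: positive_extensions_def positive_operator_on_def)
  moreover have "dense_for N D"
    unfolding dense_for_def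
  proof (intro allI)
    fix y
    interpret N: positive_form sE "\<lambda>x y. ip (N x) y" by (rule positive_formI[OF N_add N_scale N_pos])
    have mem: "u y n \<in> D" for n using u unfolding P.projection_seq_def by blast
    have "N.sqn (u y n - y) = P.sqn (u y n) - 2 * Re (ip (P (u y n)) y) + N.sqn y" for n
      using N.sqn_diff[of "u y n" y] N_D[OF mem] by (simp add: N.sqn_def P.sqn_def)
    moreover have "(\<lambda>n. P.sqn (u y n)) \<longlonglongrightarrow> N.sqn y"
      using tendsto_Re[OF sqn_lim[of y]] by (simp add: N.sqn_def)
    moreover have "(\<lambda>n. Re (ip (P (u y n)) y)) \<longlonglongrightarrow> N.sqn y"
      using tendsto_Re[OF N[of y y]] by (simp add: N.sqn_def)
    ultimately have "(\<lambda>n. N.sqn (u y n - y)) \<longlonglongrightarrow> N.sqn y - 2 * N.sqn y + N.sqn y"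
      by (simp only:) (intro tendsto_intros)
    then show "\<exists>u. (\<forall>n. u n \<in> D) \<and> (\<lambda>n. Re (ip (N (u n - y)) (u n - y))) \<longlonglongrightarrow> 0"
      using mem by (intro exI[of _ "u y"]) (simp add: N.sqn_def)
  qed
  ultimately show ?thesis by blast
qed

text \<open>Both forms agree on \<open>D\<close>, so Cauchy-Schwarz for \<open>Q\<close> between
  \<open>u n\<close> and \<open>y\<close> bounds, in the limit, the square of \<open>N.sqn y\<close>
  by \<open>N.sqn y * Q.sqn y\<close>.\<close>

lemma dense_positive_extension_least:
  assumes N: "N \<in> positive_extensions sE sF ip D A" and dense: "dense_for N D"
    and Q: "Q \<in> positive_extensions sE sF ip D A"
  shows "operator_le ip N Q"
  unfolding operator_le_def
proof
  fix y
  interpret N: positive_form sE "\<lambda>x y. ip (N x) y" by (rule positive_extension_form[OF N])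
  interpret Q: positive_form sE "\<lambda>x y. ip (Q x) y" by (rule positive_extension_form[OF Q])
  obtain u where u: "\<And>n. u n \<in> D" "(\<lambda>n. N.sqn (u n - y)) \<longlonglongrightarrow> 0"
    using dense unfolding dense_for_def N.sqn_def by blast
  have same: "Q x = N x" if "x \<in> D" for x
    using that N Q by (simp add: positive_extensions_def)
  have "(cmod (ip (N (u n)) y))^2 \<le> N.sqn (u n) * Q.sqn y" for n
    using Q.Cauchy_Schwarz[of "u n" y] same[OF u(1)] by (simp add: N.sqn_def Q.sqn_def)
  moreover have "(\<lambda>n. (cmod (ip (N (u n)) y))^2) \<longlonglongrightarrow> (cmod (ip (N y) y))^2"
    by (intro tendsto_intros N.form_tendsto u)
  moreover have "(\<lambda>n. N.sqn (u n) * Q.sqn y) \<longlonglongrightarrow> N.sqn y * Q.sqn y"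
    by (intro tendsto_intros N.sqn_tendsto u)
  ultimately have "(cmod (ip (N y) y))^2 \<le> N.sqn y * Q.sqn y" using LIMSEQ_le by blast
  then have "N.sqn y * N.sqn y \<le> N.sqn y * Q.sqn y"
    by (simp add: N.form_self power2_eq_square)
  then have "N.sqn y \<le> Q.sqn y"
    using N.sqn_nonneg[of y] Q.sqn_nonneg[of y]
    by (cases "N.sqn y = 0") (auto simp: mult_le_cancel_left)
  then show "ip (Q y - N y) y \<in> \<real>\<^sub>\<ge>\<^sub>0"
    by (simp add: ip_diff_left N.form_self Q.form_self complex_nonneg_Reals_iff)
qed

lemma krein_von_neumann_dense:
  assumes "weak_star_seq_complete ip" "subpositive sE sF ip D A"
  shows "krein_von_neumann sE sF ip D A \<in> positive_extensions sE sF ip D A"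
    and "dense_for (krein_von_neumann sE sF ip D A) D"
proof -
  obtain P where "P \<in> positive_extensions sE sF ip D A" and D: "E.subspace D"
    using assms(2) by (auto simp: subpositive_def linear_operator_on_def)
  then obtain N where N: "N \<in> positive_extensions sE sF ip D A" "dense_for N D"
    using dense_positive_extension_exists[OF assms(1)] by blast
  have "krein_von_neumann sE sF ip D A = N"
    unfolding krein_von_neumann_def
  proof (rule the_equality)
    show "N \<in> positive_extensions sE sF ip D A \<and> (\<forall>S\<in>positive_extensions sE sF ip D A. operator_le ip N S)"
      using N dense_positive_extension_least by blast
  next
    fix T assume "T \<in> positive_extensions sE sF ip D A \<and>
      (\<forall>S\<in>positive_extensions sE sF ip D A. operator_le ip T S)"
    then show "T = N"
      using N dense_positive_extension_least[OF N] operator_le_antisym[of T N]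
      by (auto simp: positive_extensions_def)
  qed
  then show "krein_von_neumann sE sF ip D A \<in> positive_extensions sE sF ip D A"
    and "dense_for (krein_von_neumann sE sF ip D A) D" using N by auto
qed

text \<open>The inclusions make \<open>B\<close> and \<open>C\<close> adjoint on \<open>D\<close>
  for the form of \<open>N\<close>. The spectrum bounds both there, and density carries the relation
  to all of \<open>E\<close>.\<close>

lemma krein_von_neumann_commutation:
  assumes complete: "weak_star_seq_complete ip" and sub: "subpositive sE sF ip D A"
    and B: "B \<in> weak_ops_EE sE ip" and C: "C \<in> weak_ops_EE sE ip"
    and BD: "B ` D \<subseteq> D" and CD: "C ` D \<subseteq> D"
    and spec: "bounded (spectrum_on sE ip D (B \<circ> C))"
    and AB: "\<forall>x\<in>D. adj ip C (A x) = A (B x)"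
    and AC: "\<forall>x\<in>D. adj ip B (A x) = A (C x)"
  defines "N \<equiv> krein_von_neumann sE sF ip D A"
  shows "adj ip C (N y) = N (B y)" "adj ip B (N y) = N (C y)"
proof -
  have D: "E.subspace D" using sub by (simp add: subpositive_def linear_operator_on_def)
  have N: "N \<in> positive_extensions sE sF ip D A" and dense: "dense_for N D"
    unfolding N_def by (rule krein_von_neumann_dense[OF complete sub])+
  interpret N: positive_form sE "\<lambda>x y. ip (N x) y" by (rule positive_extension_form[OF N])
  have NA: "N x = A x" if "x \<in> D" for x using N that by (simp add: positive_extensions_def)
  have lin: "N.linear_on D B" "N.linear_on D C"
    using BD CD by (simp_all add: N.linear_on_def weak_ops_EE_add[OF B] weak_ops_EE_add[OF C]
        weak_ops_EE_scale[OF B] weak_ops_EE_scale[OF C])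
  have NB: "ip (N (B x)) y = ip (N x) (C y)" if "x \<in> D" for x y
    using that AB BD ip_adj[OF C, of "A x" y] NA by (metis image_subset_iff)
  have NC: "ip (N (C x)) y = ip (N x) (B y)" if "x \<in> D" for x y
    using that AC CD ip_adj[OF B, of "A x" y] NA by (metis image_subset_iff)
  obtain R where R: "\<And>z. z \<in> spectrum_on sE ip D (B \<circ> C) \<Longrightarrow> cmod z \<le> R"
    using spec by (auto simp: bounded_iff)
  \<comment> \<open>Strictly beyond the spectrum; \<open>R\<close> may be negative if the spectrum
    is empty, hence the absolute value.\<close>
  define c where "c = \<bar>R\<bar> + 1"
  have c: "0 < c" by (simp add: c_def)
  have bij: "bij_betw (\<lambda>x. B (C x) - sE z x) D D" if "c \<le> cmod z" for z
  proof -
    have "z \<notin> spectrum_on sE ip D (B \<circ> C)" using R[of z] that by (auto simp: c_def)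
    then show ?thesis by (simp add: spectrum_on_def)
  qed
  have bound: "N.sqn (B x) \<le> c * N.sqn x" "N.sqn (C x) \<le> c * N.sqn x" if "x \<in> D" for x
    using N.bounded_of_adjoint_pair[OF D lin NB c bij that] by blast+
  have dense': "\<exists>u. (\<forall>n. u n \<in> D) \<and> (\<lambda>n. N.sqn (u n - y)) \<longlonglongrightarrow> 0" for y
    using dense unfolding dense_for_def N.sqn_def by blast
  have "ip (N (B y)) z = ip (N y) (C z)" for z
    by (rule N.adjoint_pair_extends[of c D B C, OF less_imp_le[OF c] dense' bound(1) weak_ops_EE_diff[OF C] NB NC])
  then show "adj ip C (N y) = N (B y)" by (rule adj_eqI)
  have "ip (N (C y)) z = ip (N y) (B z)" for z
    by (rule N.adjoint_pair_extends[of c D C B, OF less_imp_le[OF c] dense' bound(2) weak_ops_EE_diff[OF B] NC NB])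
  then show "adj ip B (N y) = N (C y)" by (rule adj_eqI)
qed

end

theorem theorem3p3:
  fixes sE :: "complex \<Rightarrow> 'e::ab_group_add \<Rightarrow> 'e"
    and sF :: "complex \<Rightarrow> 'f::ab_group_add \<Rightarrow> 'f"
    and ip :: "'f \<Rightarrow> 'e \<Rightarrow> complex"
    and D :: "'e set"
    and A :: "'e \<Rightarrow> 'f"
    and B C :: "'e \<Rightarrow> 'e"
  assumes "anti_dual_pair sE sF ip"
    and "weak_star_seq_complete ip"
    and "subpositive sE sF ip D A"
    and "B \<in> weak_ops_EE sE ip" and "C \<in> weak_ops_EE sE ip"
    and "B ` D \<subseteq> D" and "C ` D \<subseteq> D"
    and "bounded (spectrum_on sE ip D (B \<circ> C))"
    and "\<forall>x\<in>D. adj ip C (A x) = A (B x)"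
    and "\<forall>x\<in>D. adj ip B (A x) = A (C x)"
  shows "adj ip C \<circ> krein_von_neumann sE sF ip D A = krein_von_neumann sE sF ip D A \<circ> B
       \<and> adj ip B \<circ> krein_von_neumann sE sF ip D A = krein_von_neumann sE sF ip D A \<circ> C"
proof -
  interpret anti_dual_pair sE sF ip by fact
  show ?thesis
    using krein_von_neumann_commutation[OF assms(2-10)] by (simp add: fun_eq_iff)
qed

end
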